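(* Let $n\geq 12$ with $n\equiv 0\pmod 4$ and $r=5$. Let $V=\{w_1,w_2,w_3,w_4\}\sqcup\{u_1,\dots,u_{n-4}\}$ and consider the labelled graph on $V$ with edges: label $0$ on $\{w_3,u_1\},\{w_4,u_2\}$; label $1$ on $\{u_2,u_3\},\{w_2,w_3\}$; label $2$ on $\{u_1,u_2\},\{u_3,u_4\},\{w_1,w_2\},\{w_3,w_4\}$; and for $4\leq s\leq n-5$, $\{u_s,u_{s+1}\}$ with label $3$ if $s$ is even and label $4$ if $s$ is odd. Then $G\cong A_n$ and $(G,(\rho_0,\dots,\rho_4))$ is a string C-group of rank 5 with Schläfli type $\{3,4,6,n-7\}$.
   Context: A string group generated by involutions (sggi) of rank $r$ is a pair $(G,(\rho_0,\dots,\rho_{r-1}))$ where $\rho_0,\dots,\rho_{r-1}$ are involutions generating the group $G$ such that $(\rho_i\rho_j)^2=1$ whenever $|i-j|\geq 2$. It is a string C-group if in addition it satisfies the intersection property: for all $J,K\subseteq\{0,\dots,r-1\}$, $\langle \rho_j : j\in J\rangle\cap\langle\rho_k : k\in K\rangle=\langle \rho_j : j\in J\cap K\rangle$. The Schläfli type is $\{p_1,\dots,p_{r-1}\}$ where $p_i$ is the order of $\rho_{i-1}\rho_i$. Labelled-graph convention: the vertex set $V$ is finite, and each edge $\{a,b\}$ ($a\neq b$) carries one or more labels from $\{0,\dots,r-1\}$, the edges carrying any given label being pairwise disjoint; $\rho_k$ denotes the permutation of $V$ equal to the product of the transpositions $(a\,b)$ over all edges $\{a,b\}$ carrying label $k$,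 and $G=\langle\rho_0,\dots,\rho_{r-1}\rangle\leq \mathrm{Sym}(V)$. *)

theory Defs
  imports "HOL-Algebra.Algebra"
begin

definition sggi :: "('a, 'b) monoid_scheme \<Rightarrow> (nat \<Rightarrow> 'a) \<Rightarrow> nat \<Rightarrow> bool" where
  "sggi G rho r \<longleftrightarrow> group G
     \<and> (\<forall>i<r. rho i \<in> carrier G \<and> rho i \<noteq> \<one>\<^bsub>G\<^esub> \<and> rho i \<otimes>\<^bsub>G\<^esub> rho i = \<one>\<^bsub>G\<^esub>)
     \<and> generate G (rho ` {..<r}) = carrier G
     \<and> (\<forall>i<r. \<forall>j<r. (i + 2 \<le> j \<or> j + 2 \<le> i) \<longrightarrow>
          (rho i \<otimes>\<^bsub>G\<^esub> rho j) [^]\<^bsub>G\<^esub> (2::nat) = \<one>\<^bsub>G\<^esub>)"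

definition intersection_property :: "('a, 'b) monoid_scheme \<Rightarrow> (nat \<Rightarrow> 'a) \<Rightarrow> nat \<Rightarrow> bool" where
  "intersection_property G rho r \<longleftrightarrow>
     (\<forall>J K. J \<subseteq> {..<r} \<longrightarrow> K \<subseteq> {..<r} \<longrightarrow>
        generate G (rho ` J) \<inter> generate G (rho ` K) = generate G (rho ` (J \<inter> K)))"

definition string_C_group :: "('a, 'b) monoid_scheme \<Rightarrow> (nat \<Rightarrow> 'a) \<Rightarrow> nat \<Rightarrow> bool" where
  "string_C_group G rho r \<longleftrightarrow> sggi G rho r \<and> intersection_property G rho r"

definition schlafli_type :: "('a, 'b) monoid_scheme \<Rightarrow> (nat \<Rightarrow> 'a) \<Rightarrow> nat \<Rightarrow> nat list" where
  "schlafli_type G rho r = map (\<lambda>i. group.ord G (rho (i - 1) \<otimes>\<^bsub>G\<^esub> rho i)) [1..<r]"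

text \<open>A labelled graph is given by a set E of triples (k, a, b), meaning the edge {a,b}
  carries label k.  rho_k is the product of the transpositions (a b) over the edges with
  label k; since these edges are pairwise disjoint (labelled-graph convention) this is the
  map sending each endpoint of such an edge to the other endpoint and fixing everything else.\<close>

definition graph_rho :: "(nat \<times> nat \<times> nat) set \<Rightarrow> nat \<Rightarrow> nat \<Rightarrow> nat" where
  "graph_rho E k x =
     (if \<exists>y. (k, x, y) \<in> E \<or> (k, y, x) \<in> E
      then (THE y. (k, x, y) \<in> E \<or> (k, y, x) \<in> E) else x)"

text \<open>Concrete graph of Theorem 4.5 on V = {1..n}: w_i = i (i = 1..4), u_j = j + 4 (j = 1..n-4).\<close>

definition w :: "nat \<Rightarrow> nat" where "w i = i"
definition u :: "nat \<Rightarrow> nat" where "u j = j + 4"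

definition thm45_edges :: "nat \<Rightarrow> (nat \<times> nat \<times> nat) set" where
  "thm45_edges n =
     {(0, w 3, u 1), (0, w 4, u 2),
      (1, u 2, u 3), (1, w 2, w 3),
      (2, u 1, u 2), (2, u 3, u 4), (2, w 1, w 2), (2, w 3, w 4)}
     \<union> {(if even s then 3 else 4, u s, u (s + 1)) | s. 4 \<le> s \<and> s + 5 \<le> n}"

end

theory Submission
  imports Defs
begin

text \<open>
  Since \<open>(\<rho>\<^sub>2 \<rho>\<^sub>3)\<^sup>2\<close> is the 3-cycle on \<open>{7, 8, 9}\<close>, conjugating by the generators
  along the edges of the graph yields all 3-cycles on ever larger sets, so the group is the
  alternating group, all generators being even.

  Write \<open>G\<^sub>J\<close> for the subgroup generated by the \<open>\<rho>\<^sub>j\<close> with \<open>j \<in> J\<close>. The intersection property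
  amounts to saying that \<open>G\<^sub>J\<close> is the intersection of the \<open>G\<^sub>M\<close>, where \<open>M\<close> omits a single index
  outside \<open>J\<close>. Omitting an index \<open>k\<close> strictly inside the string splits the subgroup into two
  commuting factors, which reduces this to a few intersections of a subgroup on an
  interval of indices with some \<open>G\<^sub>M\<close>. These are read off from the orbits of \<open>G\<^sub>M\<close>: an element is
  multiplied by generators until it is an even permutation supported on a small set, or
  (for \<open>\<rho>\<^sub>3\<close> and \<open>\<rho>\<^sub>4\<close>) it is compared with an affine action modulo \<open>n - 7\<close>.
\<close>

section \<open>Sets of maps generated by involutions\<close>

text \<open>For a set of involutions the words in \<open>S\<close> already form the generated group;
  building them by left multiplication lets each induction treat one generator at a time, applied
  last.\<close>

inductive_set comp_span :: "('a \<Rightarrow> 'a) set \<Rightarrow> ('a \<Rightarrow> 'a) set" for S where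
  span_id: "id \<in> comp_span S"
| span_step: "s \<in> S \<Longrightarrow> g \<in> comp_span S \<Longrightarrow> s \<circ> g \<in> comp_span S"

lemma span_base: "s \<in> S \<Longrightarrow> s \<in> comp_span S"
  using span_step[OF _ span_id] by fastforce

lemma span_comp: "g \<in> comp_span S \<Longrightarrow> h \<in> comp_span S \<Longrightarrow> g \<circ> h \<in> comp_span S"
  by (induction rule: comp_span.induct) (auto simp: comp_assoc intro: span_step)

lemma span_mono: "g \<in> comp_span S \<Longrightarrow> S \<subseteq> T \<Longrightarrow> g \<in> comp_span T"
  by (induction rule: comp_span.induct) (auto intro: comp_span.intros)

text \<open>The inverse is the reversed word, because each generator is its own inverse.\<close>

lemma span_inverse:
  assumes "\<And>s. s \<in> S \<Longrightarrow> s \<circ> s = id" and "g \<in> comp_span S"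
  obtains h where "h \<in> comp_span S" "g \<circ> h = id" "h \<circ> g = id"
proof -
  from assms(2) have "\<exists>h \<in> comp_span S. g \<circ> h = id \<and> h \<circ> g = id"
  proof induction
    case span_id
    show ?case using comp_span.span_id[of S] by (intro bexI[of _ id]) simp_all
  next
    case (span_step s g)
    then obtain h where h: "h \<in> comp_span S" "g \<circ> h = id" "h \<circ> g = id" by blast
    have "s \<circ> g \<circ> (h \<circ> s) = s \<circ> (g \<circ> h) \<circ> s" by (simp add: comp_assoc)
    also have "\<dots> = id" using h assms(1) span_step by simp
    finally have 1: "s \<circ> g \<circ> (h \<circ> s) = id" .
    have "h \<circ> s \<circ> (s \<circ> g) = h \<circ> (s \<circ> s) \<circ> g" by (simp add: comp_assoc)
    also have "\<dots> = id" using h assms(1) span_step by simp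
    finally have 2: "h \<circ> s \<circ> (s \<circ> g) = id" .
    have "h \<circ> s \<in> comp_span S" using h span_step span_base span_comp by metis
    with 1 2 show ?case by blast
  qed
  with that show thesis by blast
qed

lemma span_cancel_left:
  assumes "\<And>s. s \<in> S \<Longrightarrow> s \<circ> s = id" and "h \<in> comp_span S" and "h \<circ> g \<in> comp_span S"
  shows "g \<in> comp_span S"
proof -
  obtain k where k: "k \<in> comp_span S" "k \<circ> h = id"
    using span_inverse[OF assms(1,2)] by metis
  have "k \<circ> (h \<circ> g) = g" using k by (simp add: comp_assoc[symmetric])
  then show ?thesis using span_comp[OF k(1) assms(3)] by simp
qed

lemma span_cancel_right:
  assumes "\<And>s. s \<in> S \<Longrightarrow> s \<circ> s = id" and "h \<in> comp_span S" and "g \<circ> h \<in> comp_span S"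
  shows "g \<in> comp_span S"
proof -
  obtain k where k: "k \<in> comp_span S" "h \<circ> k = id"
    using span_inverse[OF assms(1,2)] by metis
  have "(g \<circ> h) \<circ> k = g" using k by (simp add: comp_assoc)
  then show ?thesis using span_comp[OF assms(3) k(1)] by simp
qed

lemma span_commute:
  assumes "g \<in> comp_span S" and "\<And>s. s \<in> S \<Longrightarrow> h \<circ> s = s \<circ> h"
  shows "h \<circ> g = g \<circ> h"
  using assms(1)
proof induction
  case (span_step s g)
  then show ?case using assms(2) by (metis comp_assoc)
qed simp

text \<open>A letter from \<open>T\<close> commutes with the whole \<open>S\<close>-part of a word
  and can be moved past it, so the letters can be sorted.\<close>

lemma span_Un_commuting:
  assumes "g \<in> comp_span (S \<union> T)" and "\<And>s t. s \<in> S \<Longrightarrow> t \<in> T \<Longrightarrow> s \<circ> t = t \<circ> s"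
  obtains a b where "a \<in> comp_span S" "b \<in> comp_span T" "g = a \<circ> b"
proof -
  from assms(1) have "\<exists>a \<in> comp_span S. \<exists>b \<in> comp_span T. g = a \<circ> b"
  proof induction
    case span_id
    show ?case by (metis comp_id comp_span.span_id)
  next
    case (span_step s g)
    then obtain a b where ab: "a \<in> comp_span S" "b \<in> comp_span T" "g = a \<circ> b" by blast
    show ?case
    proof (cases "s \<in> S")
      case True
      then show ?thesis using ab by (metis comp_assoc comp_span.span_step)
    next
      case False
      with span_step have s: "s \<in> T" by blast
      have "s \<circ> a = a \<circ> s" using span_commute[OF ab(1)] assms(2) s by metis
      then have "s \<circ> g = a \<circ> (s \<circ> b)" using ab by (simp add: comp_assoc[symmetric])
      then show ?thesis using ab s comp_span.span_step by blast
    qed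
  qed
  with that show thesis by blast
qed

lemma span_invariant:
  assumes "g \<in> comp_span S" "x \<in> A" "\<And>s x. s \<in> S \<Longrightarrow> x \<in> A \<Longrightarrow> s x \<in> A"
  shows "g x \<in> A"
  using assms(1,2) by induction (auto intro: assms(3))

lemma span_singleton:
  assumes "s \<circ> s = id" and "g \<in> comp_span {s}"
  shows "g = id \<or> g = s"
  using assms(2)
proof induction
  case (span_step t g)
  then have "t = s" by simp
  with span_step.IH assms(1) show ?case by (metis comp_id)
qed simp

text \<open>The bridge to \<open>generate\<close>. Keeping \<open>G\<close> general lets it serve
  both the alternating and the symmetric group.\<close>

lemma generate_eq_span:
  assumes "group G" and "monoid.mult G = (\<circ>)" and "\<one>\<^bsub>G\<^esub> = id"
    and "S \<subseteq> carrier G" and "\<And>s. s \<in> S \<Longrightarrow> s \<circ> s = id"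
  shows "generate G S = comp_span S"
proof
  interpret group G by fact
  have inv: "inv\<^bsub>G\<^esub> s = s" if "s \<in> S" for s
    using that assms by (metis inv_equality subsetD)
  show "generate G S \<subseteq> comp_span S"
  proof
    fix g assume "g \<in> generate G S"
    then show "g \<in> comp_span S"
    proof induction
      case (eng h1 h2)
      then show ?case unfolding assms(2) by (simp only: span_comp)
    qed (simp_all only: assms(3) inv span_id span_base)
  qed
  show "comp_span S \<subseteq> generate G S"
  proof
    fix g assume "g \<in> comp_span S"
    then show "g \<in> generate G S"
    proof induction
      case span_id
      show ?case using generate.one[of G S] by (simp only: assms(3))
    next
      case (span_step s g)
      then show ?case using generate.eng[OF generate.incl[of s S G], of g] by (simp only: assms(2))
    qed
  qed
qed

section \<open>Three-cycles and alternating groups\<close>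

definition cycle3 :: "'a \<Rightarrow> 'a \<Rightarrow> 'a \<Rightarrow> 'a \<Rightarrow> 'a" where
  "cycle3 a b c = transpose a b \<circ> transpose b c"

lemma cycle3_apply:
  assumes "distinct [a, b, c]"
  shows "cycle3 a b c x = (if x = a then b else if x = b then c else if x = c then a else x)"
  using assms by (auto simp: cycle3_def transpose_def)

lemma cycle3_rotate:
  assumes "distinct [a, b, c]"
  shows "cycle3 b c a = cycle3 a b c"
  using assms by (auto simp: cycle3_def transpose_def fun_eq_iff)

lemma cycle3_square:
  assumes "distinct [a, b, c]"
  shows "cycle3 a b c \<circ> cycle3 a b c = cycle3 a c b"
  using assms by (auto simp: cycle3_def transpose_def fun_eq_iff)

lemma permutation_cycle3: "permutation (cycle3 a b c)"
  unfolding cycle3_def by (intro permutation_compose permutation_swap_id)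

lemma evenperm_cycle3:
  assumes "distinct [a, b, c]"
  shows "evenperm (cycle3 a b c)"
  using assms unfolding cycle3_def by (simp add: evenperm_comp evenperm_swap permutation_swap_id)

text \<open>Conjugation relabels the entries of a cycle; the form with \<open>g\<close> moved to the
  right avoids an explicit inverse.\<close>

lemma comp_cycle3:
  assumes "inj g"
  shows "g \<circ> cycle3 a b c = cycle3 (g a) (g b) (g c) \<circ> g"
  using assms by (auto simp: cycle3_def transpose_def fun_eq_iff inj_eq)

definition has_cycles3 :: "('a \<Rightarrow> 'a) set \<Rightarrow> 'a set \<Rightarrow> bool" where
  "has_cycles3 H A \<longleftrightarrow> (\<forall>a\<in>A. \<forall>b\<in>A. \<forall>c\<in>A. distinct [a, b, c] \<longrightarrow> cycle3 a b c \<in> H)"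

lemma has_cycles3_triple:
  assumes "distinct [a, b, c]" and "cycle3 a b c \<in> comp_span S"
  shows "has_cycles3 (comp_span S) {a, b, c}"
proof -
  have "cycle3 a c b \<in> comp_span S"
    using span_comp[OF assms(2,2)] by (simp only: cycle3_square[OF assms(1)])
  with assms show ?thesis
    unfolding has_cycles3_def using cycle3_rotate[of a b c] cycle3_rotate[of b c a]
      cycle3_rotate[of a c b] cycle3_rotate[of c b a] by auto
qed

text \<open>Call a pair \<open>(c, d)\<close> in \<open>A\<close> good if the cycle
  \<open>(c d x)\<close> is available. Squaring makes this symmetric, and composing with a 3-cycle
  inside \<open>A\<close> exchanges one entry, so a single good pair makes all pairs good.\<close>

lemma has_cycles3_insert:
  assumes H: "has_cycles3 (comp_span S) A" and "a \<in> A" "b \<in> A" "distinct [a, b, x]"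
    and abx: "cycle3 a b x \<in> comp_span S"
  shows "has_cycles3 (comp_span S) (insert x A)"
proof (cases "x \<in> A")
  case False
  define P where "P c d \<longleftrightarrow> c \<noteq> d \<and> c \<in> A \<and> d \<in> A \<and> cycle3 c d x \<in> comp_span S" for c d
  have sym: "P d c" if "P c d" for c d
  proof -
    have D: "distinct [x, c, d]" using that False by (auto simp: P_def)
    have "cycle3 x c d \<in> comp_span S" using that cycle3_rotate[OF D] by (simp add: P_def)
    then have "cycle3 x d c \<in> comp_span S"
      using span_comp[of "cycle3 x c d" S "cycle3 x c d"] cycle3_square[OF D] by simp
    moreover have "cycle3 d c x = cycle3 x d c" using D cycle3_rotate[of x d c] by auto
    ultimately show ?thesis using that by (auto simp: P_def)
  qed
  have repl: "P e d" if "P c d" "e \<in> A" "e \<noteq> d" for c d e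
  proof (cases "e = c")
    case False
    have D: "distinct [c, d, e, x]" using that False \<open>x \<notin> A\<close> by (auto simp: P_def)
    have "cycle3 c d e \<in> comp_span S"
      using that D H by (auto simp: P_def has_cycles3_def)
    moreover have "cycle3 d c x \<in> comp_span S" using sym[OF that(1)] by (simp add: P_def)
    \<comment> \<open>In the product \<open>d\<close> goes to \<open>e\<close>, \<open>e\<close> via
      \<open>c\<close> to \<open>x\<close>, and \<open>x\<close> to \<open>d\<close>, while
      \<open>c\<close> returns to itself: the entry \<open>c\<close> is traded for
      \<open>e\<close>.\<close>
    moreover have "cycle3 d e x = cycle3 d c x \<circ> cycle3 c d e"
      using D by (auto simp: cycle3_def transpose_def fun_eq_iff)
    ultimately have "cycle3 d e x \<in> comp_span S" using span_comp by metis
    then have "P d e" using that by (simp add: P_def)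
    then show ?thesis by (rule sym)
  qed (use that in simp)
  have "P a b" using assms by (auto simp: P_def)
  then have all: "P c d" if "c \<in> A" "d \<in> A" "c \<noteq> d" for c d
  proof (cases "c = b")
    case True
    then show ?thesis using that repl[OF \<open>P a b\<close>, of d] sym repl[OF sym[OF \<open>P a b\<close>], of d] by blast
  next
    case False
    then have "P b c" using that repl[OF \<open>P a b\<close>, of c] sym by blast
    then show ?thesis using that repl[of b c d] sym by blast
  qed
  have new: "cycle3 c d x \<in> comp_span S" if "c \<in> A" "d \<in> A" "c \<noteq> d" for c d
    using all[OF that] by (simp add: P_def)
  have "cycle3 c d e \<in> comp_span S"
    if cde: "c \<in> insert x A" "d \<in> insert x A" "e \<in> insert x A" "distinct [c, d, e]" for c d e
  proof -
    consider "c \<in> A" "d \<in> A" "e \<in> A" | "c = x" "d \<in> A" "e \<in> A" | "d = x" "c \<in> A" "e \<in> A"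
      | "e = x" "c \<in> A" "d \<in> A" using cde by auto
    then show ?thesis
    proof cases
      case 1
      then show ?thesis using H cde by (simp add: has_cycles3_def)
    next
      case 2
      then show ?thesis using new[of d e] cde cycle3_rotate[of c d e] by simp
    next
      case 3
      then show ?thesis using new[of e c] cde cycle3_rotate[of c d e] cycle3_rotate[of d e c] by auto
    next
      case 4
      then show ?thesis using new[of c d] cde by simp
    qed
  qed
  then show ?thesis by (simp add: has_cycles3_def)
qed (use H in \<open>simp add: insert_absorb\<close>)

text \<open>Conjugating \<open>(a b c)\<close> by \<open>r\<close> keeps two entries in
  \<open>A\<close> and turns the third into \<open>x\<close>. This is how 3-cycles spread along an
  edge from \<open>c\<close> to \<open>x\<close>.\<close>

lemma has_cycles3_extend:
  assumes H: "has_cycles3 (comp_span S) A" and r: "r \<in> S" "r \<circ> r = id"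
    and "a \<in> A" "b \<in> A" "c \<in> A" "distinct [a, b, c]" "r a \<in> A" "r b \<in> A" "r c = x"
  shows "has_cycles3 (comp_span S) (insert x A)"
proof -
  have inj: "inj r" using r(2) by (metis inj_on_id inj_on_imageI2)
  have "r \<circ> cycle3 a b c \<circ> r = cycle3 (r a) (r b) (r c)"
    using r(2) by (simp add: comp_cycle3[OF inj] comp_assoc)
  moreover have "cycle3 a b c \<in> comp_span S"
    using H assms by (simp add: has_cycles3_def)
  ultimately have "cycle3 (r a) (r b) x \<in> comp_span S"
    using span_comp span_base r(1) assms(10) by metis
  moreover have "distinct [r a, r b, x]" using inj assms by (auto simp: inj_eq)
  ultimately show ?thesis using has_cycles3_insert[OF H, of "r a" "r b" x] assms(8,9) by simp
qed

text \<open>Composing with the 3-cycle taking \<open>p a\<close> back to \<open>a\<close> shrinks the support of \<open>p\<close>.\<close>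

lemma even_permutation_in_span:
  assumes H: "has_cycles3 (comp_span S) A" and inv: "\<And>s. s \<in> S \<Longrightarrow> s \<circ> s = id"
    and "finite A" "p permutes A" "evenperm p"
  shows "p \<in> comp_span S"
  using assms(4,5)
proof (induction "card {x. p x \<noteq> x}" arbitrary: p rule: less_induct)
  case less
  have fin: "finite {x. q x \<noteq> x}" if "q permutes A" for q
    using that \<open>finite A\<close> by (rule_tac finite_subset[of _ A]) (auto simp: permutes_def)
  show ?case
  proof (cases "p = id")
    case True
    then show ?thesis by (simp add: span_id)
  next
    case False
    then obtain a where a: "p a \<noteq> a" by (auto simp: fun_eq_iff)
    define b where "b = p a"
    have inj: "inj p" using less.prems permutes_inj by blast
    have pb: "p b \<noteq> b" using a inj by (metis b_def injD)
    \<comment> \<open>If only \<open>a\<close> and \<open>b\<close> were moved, \<open>p\<close>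
      would be a transposition, which is odd.\<close>
    have "\<exists>c. c \<noteq> a \<and> c \<noteq> b \<and> p c \<noteq> c"
    proof (rule ccontr)
      assume "\<not> ?thesis"
      then have fix': "p c = c" if "c \<noteq> a" "c \<noteq> b" for c using that by blast
      have "p b = a"
        using pb fix' inj a by (metis b_def injD)
      then have "p = transpose a b"
        using fix' b_def by (auto simp: fun_eq_iff transpose_def)
      then show False using less.prems(2) a evenperm_swap[of a b] b_def by metis
    qed
    then obtain c where c: "c \<noteq> a" "c \<noteq> b" "p c \<noteq> c" by blast
    have D: "distinct [b, a, c]" using a c b_def by auto
    have A: "a \<in> A" "b \<in> A" "c \<in> A" using a pb c less.prems by (auto simp: permutes_def)
    let ?q = "cycle3 b a c \<circ> p"
    have cyc: "cycle3 b a c permutes A"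
      unfolding cycle3_def using A by (intro permutes_compose permutes_swap_id)
    then have q: "?q permutes A" using less.prems permutes_compose by blast
    have perm: "permutation p" using less.prems \<open>finite A\<close> permutation_permutes by blast
    have qe: "evenperm ?q"
      using less.prems evenperm_comp[OF permutation_cycle3 perm] evenperm_cycle3[OF D] by simp
    have "?q a = a" using b_def cycle3_apply[OF D] by simp
    moreover have "?q x = x" if "p x = x" for x
    proof -
      have "x \<noteq> a" "x \<noteq> b" "x \<noteq> c" using that a pb c by auto
      then show ?thesis using that cycle3_apply[OF D] by simp
    qed
    ultimately have "{x. ?q x \<noteq> x} \<subset> {x. p x \<noteq> x}" using a by blast
    then have "card {x. ?q x \<noteq> x} < card {x. p x \<noteq> x}"
      using fin[OF less.prems(1)] psubset_card_mono by blast
    then have "?q \<in> comp_span S" using less.hyps q qe by blast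
    moreover have "cycle3 b a c \<in> comp_span S" using H A D by (simp add: has_cycles3_def)
    ultimately show ?thesis using span_cancel_left[OF inv] by blast
  qed
qed

text \<open>The product of \<open>k\<close> disjoint transpositions of neighbours,
  \<open>(a a+1)(a+2 a+3)...\<close>; the permutations of the labels 3 and 4 on the long path have
  this form.\<close>

definition swaps :: "nat \<Rightarrow> nat \<Rightarrow> nat \<Rightarrow> nat" where
  "swaps a k x = (if a \<le> x \<and> x < a + 2 * k then if even (x - a) then x + 1 else x - 1 else x)"

lemma swaps_Suc: "swaps a (Suc k) = transpose (a + 2 * k) (a + 2 * k + 1) \<circ> swaps a k"
proof
  fix x
  consider "x < a + 2 * k" | "x = a + 2 * k" | "x = a + 2 * k + 1" | "x > a + 2 * k + 1" by linarith
  then show "swaps a (Suc k) x = (transpose (a + 2 * k) (a + 2 * k + 1) \<circ> swaps a k) x"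
  proof cases
    case 1
    have "swaps a k x < a + 2 * k" using 1 unfolding swaps_def by (auto split: if_splits; presburger) 
    with 1 show ?thesis by (simp add: transpose_def) (simp add: swaps_def)
  qed (auto simp: swaps_def transpose_def)
qed

lemma swaps_0: "swaps a 0 = id"
  by (auto simp: swaps_def)

lemma permutation_swaps: "permutation (swaps a k)"
proof (induction k)
  case (Suc k)
  then show ?case unfolding swaps_Suc by (rule permutation_compose[OF permutation_swap_id])
qed (simp add: swaps_0)

lemma evenperm_swaps: "evenperm (swaps a k) \<longleftrightarrow> even k"
proof (induction k)
  case (Suc k)
  then show ?case unfolding swaps_Suc
    by (subst evenperm_comp) (auto simp: permutation_swap_id permutation_swaps evenperm_swap)
qed (simp add: swaps_0)

lemma swaps_swaps: "swaps a k (swaps a k x) = x"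
proof (cases "a \<le> x \<and> x < a + 2 * k")
  case True
  then obtain i where i: "x = a + i" "i < 2 * k" by (metis le_iff_add nat_add_left_cancel_less)
  show ?thesis
  proof (cases "even i")
    case True
    then have "Suc i < 2 * k" using i(2) by presburger
    with True i show ?thesis by (simp add: swaps_def)
  next
    case False
    then obtain j where "i = Suc j" by (cases i) auto
    with False i show ?thesis by (simp add: swaps_def)
  qed
qed (auto simp: swaps_def)

lemma comp_disjoint_supports:
  assumes "\<And>x. x \<in> A \<Longrightarrow> f x \<in> A \<and> g x = x" and "\<And>x. x \<notin> A \<Longrightarrow> g x \<notin> A \<and> f x = x"
  shows "f \<circ> g = g \<circ> f"
proof
  fix x show "(f \<circ> g) x = (g \<circ> f) x"
    by (cases "x \<in> A") (simp_all add: assms)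
qed

lemma graph_rho_edge:
  assumes "(k, x, y) \<in> E \<or> (k, y, x) \<in> E"
    and "\<And>y'. (k, x, y') \<in> E \<or> (k, y', x) \<in> E \<Longrightarrow> y' = y"
  shows "graph_rho E k x = y"
proof -
  have "(THE y. (k, x, y) \<in> E \<or> (k, y, x) \<in> E) = y"
    using assms by (rule the_equality)
  then show ?thesis unfolding graph_rho_def using assms(1) by (simp only: if_P exI[of _ y])
qed

lemma graph_rho_fixed:
  assumes "\<And>y. (k, x, y) \<notin> E \<and> (k, y, x) \<notin> E"
  shows "graph_rho E k x = x"
  using assms by (simp add: graph_rho_def)

text \<open>Restricted to \<open>A\<close>, every generator is trivial or the same involution
  \<open>t\<close>, so the span acts there through a group of order at most two.\<close>

lemma span_acts_on:
  assumes "g \<in> comp_span S" and "\<And>x. x \<in> A \<Longrightarrow> t x \<in> A" and "t \<circ> t = id"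
    and "\<And>s. s \<in> S \<Longrightarrow> (\<forall>x\<in>A. s x = x) \<or> (\<forall>x\<in>A. s x = t x)"
  shows "(\<forall>x\<in>A. g x = x) \<or> (\<forall>x\<in>A. g x = t x)"
  using assms(1)
proof induction
  case (span_step s g)
  have "t (t x) = x" for x using assms(3) by (metis comp_apply id_apply)
  then show ?case using span_step.IH assms(4)[OF span_step.hyps(1)] assms(2) by auto
qed simp

text \<open>Supplies the factor that cancels the action of \<open>g\<close> on \<open>A\<close>,
  leaving an element with smaller support.\<close>

lemma acts_on_correction:
  assumes "(\<forall>x\<in>A. g x = x) \<or> (\<forall>x\<in>A. g x = t x)" and "t \<circ> t = id"
  obtains a where "a = id \<or> a = t" "\<And>x. x \<in> A \<Longrightarrow> a (g x) = x"
proof -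
  have "t (t x) = x" for x using assms(2) by (metis comp_apply id_apply)
  then show thesis using assms(1) that[of id] that[of t] by auto
qed

text \<open>Exponents can be reduced modulo \<open>d\<close>, so an order is certified by checking
  finitely many powers.\<close>

lemma funpow_eq_id_iff:
  assumes "f ^^ d = id" "0 < d" "\<And>j. 0 < j \<Longrightarrow> j < d \<Longrightarrow> f ^^ j \<noteq> id"
  shows "f ^^ k = id \<longleftrightarrow> d dvd k"
proof -
  have "f ^^ k = f ^^ (k mod d)"
    using funpow_mod_eq[of d f _ k] assms(1) by (auto simp: fun_eq_iff)
  moreover have "k mod d < d" using assms(2) by simp
  ultimately show ?thesis using assms(3)[of "k mod d"] by (auto simp: mod_eq_0_iff_dvd)
qed

lemma alt_group_pow: "x [^]\<^bsub>alt_group n\<^esub> (k::nat) = x ^^ k"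
proof (induction k)
  case 0
  show ?case by (simp add: nat_pow_def alt_group_one id_def)
next
  case (Suc k)
  interpret group "alt_group n" by (rule alt_group_is_group)
  show ?case using Suc by (simp only: nat_pow_Suc alt_group_mult funpow_Suc_right)
qed

lemma ord_alt_group:
  assumes "x \<in> carrier (alt_group n)" "\<And>k. x ^^ k = id \<longleftrightarrow> d dvd k"
  shows "group.ord (alt_group n) x = d"
  using group.ord_unique[OF alt_group_is_group assms(1), of d] assms(2)
  by (simp only: alt_group_pow alt_group_one) blast

section \<open>The generators\<close>

locale alternating_graph =
  fixes n :: nat
  assumes n_ge: "12 \<le> n" and n_mod: "n mod 4 = 0"
begin

lemma even_n: "even n" using n_mod by presburger

text \<open>Closed forms of the generators. With \<open>w i = i\<close> and
  \<open>u j = j + 4\<close> the vertices are 1 to \<open>n\<close>, and the labels 3 and 4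
  alternate along the path from 8 to \<open>n\<close>, starting with 3. Writing them as products of
  transpositions makes the parity computable.\<close>

definition r0 :: "nat \<Rightarrow> nat" where "r0 = transpose 3 5 \<circ> transpose 4 6"
definition r1 :: "nat \<Rightarrow> nat" where "r1 = transpose 6 7 \<circ> transpose 2 3"
definition r2 :: "nat \<Rightarrow> nat" where
  "r2 = transpose 5 6 \<circ> transpose 7 8 \<circ> transpose 1 2 \<circ> transpose 3 4"
definition r3 :: "nat \<Rightarrow> nat" where "r3 = swaps 8 ((n - 8) div 2)"
definition r4 :: "nat \<Rightarrow> nat" where "r4 = swaps 9 ((n - 8) div 2)"

lemma r0_apply: "r0 x = (if x = 3 then 5 else if x = 5 then 3 else if x = 4 then 6 else if x = 6 then 4 else x)"
  by (simp add: r0_def transpose_def)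

lemma r1_apply: "r1 x = (if x = 6 then 7 else if x = 7 then 6 else if x = 2 then 3 else if x = 3 then 2 else x)"
  by (simp add: r1_def transpose_def)

lemma r2_apply: "r2 x = (if x = 5 then 6 else if x = 6 then 5 else if x = 7 then 8 else if x = 8 then 7
   else if x = 1 then 2 else if x = 2 then 1 else if x = 3 then 4 else if x = 4 then 3 else x)"
  by (simp add: r2_def transpose_def)

lemma r3_apply: "r3 x = (if 8 \<le> x \<and> x < n then if even x then x + 1 else x - 1 else x)"
proof -
  have "8 + 2 * ((n - 8) div 2) = n" using even_n n_ge by auto
  then show ?thesis unfolding r3_def swaps_def by auto
qed

lemma r4_apply: "r4 x = (if 9 \<le> x \<and> x \<le> n then if odd x then x + 1 else x - 1 else x)"
proof -
  have "9 + 2 * ((n - 8) div 2) = n + 1" using even_n n_ge by auto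
  then show ?thesis unfolding r4_def swaps_def by auto
qed

lemmas r_apply = r0_apply r1_apply r2_apply r3_apply r4_apply

section \<open>Agreement of the labelled graph with the closed forms\<close>

lemma edge_iff: "(k, a, b) \<in> thm45_edges n \<longleftrightarrow>
    (k, a, b) \<in> {(0, 3, 5), (0, 4, 6), (1, 6, 7), (1, 2, 3), (2, 5, 6), (2, 7, 8), (2, 1, 2), (2, 3, 4)}
    \<or> (b = a + 1 \<and> 8 \<le> a \<and> a < n \<and> k = (if even a then 3 else 4))"
proof -
  have "(\<exists>s. (k, a, b) = (if even s then 3 else 4, s + 4, s + 1 + 4) \<and> 4 \<le> s \<and> s + 5 \<le> n)
     \<longleftrightarrow> (b = a + 1 \<and> 8 \<le> a \<and> a < n \<and> k = (if even a then 3 else 4))" (is "?L = ?R")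
  proof
    assume ?R
    \<comment> \<open>The path edge starting at the vertex \<open>a = u s\<close> has index
      \<open>s = a - 4\<close>.\<close>
    then show ?L by (intro exI[of _ "a - 4"]) auto
  qed auto
  then show ?thesis by (auto simp: thm45_edges_def w_def u_def)
qed

lemma graph_rho_0: "graph_rho (thm45_edges n) 0 = r0"
proof
  fix x show "graph_rho (thm45_edges n) 0 x = r0 x"
    by (cases "x \<in> {3, 4, 5, 6}")
      (auto simp: edge_iff r0_apply intro!: graph_rho_edge graph_rho_fixed split: if_splits)
qed

lemma graph_rho_1: "graph_rho (thm45_edges n) (Suc 0) = r1"
proof
  fix x show "graph_rho (thm45_edges n) (Suc 0) x = r1 x"
    by (cases "x \<in> {2, 3, 6, 7}")
      (auto simp: edge_iff r1_apply intro!: graph_rho_edge graph_rho_fixed split: if_splits)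
qed

lemma graph_rho_2: "graph_rho (thm45_edges n) 2 = r2"
proof
  fix x show "graph_rho (thm45_edges n) 2 x = r2 x"
    by (cases "x \<in> {1, 2, 3, 4, 5, 6, 7, 8}")
      (auto simp: edge_iff r2_apply intro!: graph_rho_edge graph_rho_fixed split: if_splits)
qed

lemma graph_rho_3: "graph_rho (thm45_edges n) 3 = r3"
proof
  fix x
  show "graph_rho (thm45_edges n) 3 x = r3 x"
  proof (cases "8 \<le> x \<and> x < n")
    case True
    show ?thesis
      by (rule graph_rho_edge)
        (use True even_n in \<open>auto simp: edge_iff r3_apply elim!: oddE split: if_splits\<close>)
  next
    case False
    then show ?thesis
      using even_n by (auto simp: edge_iff r3_apply intro!: graph_rho_fixed split: if_splits; presburger)
  qed
qed

lemma graph_rho_4: "graph_rho (thm45_edges n) 4 = r4"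
proof
  fix x
  show "graph_rho (thm45_edges n) 4 x = r4 x"
  proof (cases "9 \<le> x \<and> x \<le> n")
    case True
    have "(4, x, r4 x) \<in> thm45_edges n \<or> (4, r4 x, x) \<in> thm45_edges n"
      using True even_n by (auto simp: edge_iff r4_apply elim!: oddE; presburger)
    moreover have "y = r4 x" if "(4, x, y) \<in> thm45_edges n \<or> (4, y, x) \<in> thm45_edges n" for y
      using that True by (auto simp: edge_iff r4_apply split: if_splits)
    ultimately show ?thesis by (rule graph_rho_edge)
  next
    case False
    then show ?thesis
      using even_n by (auto simp: edge_iff r4_apply intro!: graph_rho_fixed split: if_splits; presburger)
  qed
qed

lemmas graph_rho_simps = graph_rho_0 graph_rho_1 graph_rho_2 graph_rho_3 graph_rho_4

section \<open>Relations, supports and parity of the generators\<close>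

lemma r0_r0: "r0 \<circ> r0 = id" by (auto simp: r_apply fun_eq_iff)
lemma r1_r1: "r1 \<circ> r1 = id" by (auto simp: r_apply fun_eq_iff)
lemma r2_r2: "r2 \<circ> r2 = id" by (auto simp: r_apply fun_eq_iff)
lemma r3_r3: "r3 \<circ> r3 = id" by (auto simp: r3_def swaps_swaps fun_eq_iff)
lemma r4_r4: "r4 \<circ> r4 = id" by (auto simp: r4_def swaps_swaps fun_eq_iff)

lemmas r_r = r0_r0 r1_r1 r2_r2 r3_r3 r4_r4

lemma r_involution: "S \<subseteq> {r0, r1, r2, r3, r4} \<Longrightarrow> s \<in> S \<Longrightarrow> s \<circ> s = id"
  using r_r by blast

text \<open>Edges of label 3 start at even vertices, so none of them crosses into
  \<open>{k..}\<close> from below when \<open>k\<close> is even.\<close>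

lemma r3_ge: "even k \<Longrightarrow> k \<le> x \<Longrightarrow> k \<le> r3 x"
  by (cases "k = x") (auto simp: r3_apply)

text \<open>Edges of label 4 start at odd vertices; the even value 8 is also allowed because
  \<open>r4\<close> fixes 8.\<close>

lemma r4_ge: "odd k \<or> k = 8 \<Longrightarrow> k \<le> x \<Longrightarrow> k \<le> r4 x"
  by (cases "k = x") (auto simp: r4_apply)

lemma r3_less: "x < 8 \<Longrightarrow> r3 x = x"
  by (simp add: r3_apply)

lemma r4_less: "x < 9 \<Longrightarrow> r4 x = x"
  by (simp add: r4_apply)

lemma r0_r2: "r0 \<circ> r2 = r2 \<circ> r0" by (auto simp: r_apply fun_eq_iff)
lemma r0_r3: "r0 \<circ> r3 = r3 \<circ> r0"
  using r3_ge[of 8] by (intro comp_disjoint_supports[of "{..<8}"]) (auto simp: not_less r0_apply r3_less)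
lemma r0_r4: "r0 \<circ> r4 = r4 \<circ> r0"
  using r4_ge[of 8] by (intro comp_disjoint_supports[of "{..<8}"]) (auto simp: not_less r0_apply r4_less)
lemma r1_r3: "r1 \<circ> r3 = r3 \<circ> r1"
  using r3_ge[of 8] by (intro comp_disjoint_supports[of "{..<8}"]) (auto simp: not_less r1_apply r3_less)
lemma r1_r4: "r1 \<circ> r4 = r4 \<circ> r1"
  using r4_ge[of 8] by (intro comp_disjoint_supports[of "{..<8}"]) (auto simp: not_less r1_apply r4_less)
lemma r2_r4: "r2 \<circ> r4 = r4 \<circ> r2"
  using r4_ge[of 9] by (intro comp_disjoint_supports[of "{..<9}"]) (auto simp: not_less r2_apply r4_less)

lemmas r_commute = r0_r2 r0_r3 r0_r4 r1_r3 r1_r4 r2_r4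

lemma r_even:
  assumes "s \<in> {r0, r1, r2, r3, r4}"
  shows "permutation s \<and> evenperm s"
proof -
  \<comment> \<open>Here divisibility of \<open>n\<close> by 4 enters: \<open>r3\<close> and
    \<open>r4\<close> are products of an even number of transpositions.\<close>
  have "even ((n - 8) div 2)" using n_mod n_ge by presburger
  then show ?thesis using assms
    by (auto simp: r0_def r1_def r2_def r3_def r4_def evenperm_swaps permutation_swaps evenperm_comp
      permutation_compose permutation_swap_id evenperm_swap)
qed

lemma r_permutes:
  assumes "s \<in> {r0, r1, r2, r3, r4}"
  shows "s permutes {1..n}"
proof -
  have "s \<circ> s = id" using assms r_involution by blast
  moreover have "s x = x" if "x \<notin> {1..n}" for x
    using assms that n_ge even_n by (auto simp: r_apply)
  ultimately show ?thesis unfolding permutes_def by (metis comp_apply id_apply)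
qed

section \<open>Identification with the alternating group\<close>

lemma span_even:
  assumes "g \<in> comp_span S" "S \<subseteq> {r0, r1, r2, r3, r4}"
  shows "g permutes {1..n}" "evenperm g"
proof -
  from assms(1) have "g permutes {1..n} \<and> permutation g \<and> evenperm g"
  proof induction
    case (span_step s g)
    then have "s \<in> {r0, r1, r2, r3, r4}" using assms(2) by blast
    with span_step show ?case using r_even r_permutes
      by (metis evenperm_comp permutation_compose permutes_compose)
  qed (simp only: permutes_id permutation_id evenperm_id simp_thms)
  then show "g permutes {1..n}" "evenperm g" by simp_all
qed

text \<open>The edges of labels 2 and 3 form the path 7 - 8 - 9 and otherwise isolated edges. Hence
  \<open>r2 \<circ> r3\<close> is a 3-cycle times disjoint transpositions, and squaring removes the
  transpositions.\<close>

lemma r2_r3_square: "(r2 \<circ> r3) \<circ> (r2 \<circ> r3) = cycle3 7 9 8"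
proof
  fix x :: nat
  have "x \<in> {0, 1, 2, 3, 4, 5, 6, 7, 8, 9} \<or> 10 \<le> x"
    by (simp, presburger)
  then show "((r2 \<circ> r3) \<circ> (r2 \<circ> r3)) x = cycle3 7 9 8 x"
  proof
    assume "x \<in> {0, 1, 2, 3, 4, 5, 6, 7, 8, 9}"
    then show ?thesis using n_ge by (elim insertE emptyE) (simp_all add: r_apply cycle3_apply)
  next
    assume x: "10 \<le> x"
    have "10 \<le> r3 x" using r3_ge[OF _ x] by simp
    moreover from this have "r2 (r3 x) = r3 x" by (simp add: r2_apply)
    moreover have "r2 x = x" using x by (simp add: r2_apply)
    ultimately show ?thesis using x fun_cong[OF r3_r3, of x] by (simp add: cycle3_apply)
  qed
qed

lemma has_cycles3_789:
  assumes "{r2, r3} \<subseteq> S"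
  shows "has_cycles3 (comp_span S) {7, 8, 9}"
proof -
  have "cycle3 7 9 8 \<in> comp_span S"
    unfolding r2_r3_square[symmetric] using assms by (intro span_comp span_base) auto
  then have "has_cycles3 (comp_span S) {7, 9, 8}" by (rule has_cycles3_triple[rotated]) simp
  then show ?thesis by (simp add: insert_commute)
qed

text \<open>The cycles spread along the edges from 7 to 6 (label 1) and from 6 to 5 (label
  2).\<close>

lemma has_cycles3_56789: "{r1, r2, r3} \<subseteq> S \<Longrightarrow> has_cycles3 (comp_span S) {5, 6, 7, 8, 9}"
proof -
  assume S: "{r1, r2, r3} \<subseteq> S"
  then have "has_cycles3 (comp_span S) {7, 8, 9}" using has_cycles3_789 by blast
  then have "has_cycles3 (comp_span S) (insert 6 {7, 8, 9})"
    by (rule has_cycles3_extend[of _ _ r1 8 9 7]) (use S r_r in \<open>auto simp: r_apply\<close>)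
  then have "has_cycles3 (comp_span S) (insert 5 {6, 7, 8, 9})"
    by (rule has_cycles3_extend[of _ _ r2 7 8 6]) (use S r_r in \<open>auto simp: r_apply\<close>)
  then show ?thesis .
qed

lemma has_cycles3_all: "has_cycles3 (comp_span {r0, r1, r2, r3, r4}) {1..n}"
proof -
  let ?H = "comp_span {r0, r1, r2, r3, r4}"
  have "has_cycles3 ?H {5, 6, 7, 8, 9}" by (rule has_cycles3_56789) simp
  then have "has_cycles3 ?H (insert 3 {5, 6, 7, 8, 9})"
    by (rule has_cycles3_extend[of _ _ r0 7 8 5]) (use r_r in \<open>auto simp: r_apply\<close>)
  then have "has_cycles3 ?H (insert 4 {3, 5, 6, 7, 8, 9})"
    by (rule has_cycles3_extend[of _ _ r0 7 8 6]) (use r_r in \<open>auto simp: r_apply\<close>)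
  then have "has_cycles3 ?H (insert 2 {4, 3, 5, 6, 7, 8, 9})"
    by (rule has_cycles3_extend[of _ _ r1 8 9 3]) (use r_r in \<open>auto simp: r_apply\<close>)
  then have "has_cycles3 ?H (insert 1 {2, 4, 3, 5, 6, 7, 8, 9})"
    by (rule has_cycles3_extend[of _ _ r2 7 8 2]) (use r_r in \<open>auto simp: r_apply\<close>)
  moreover have "insert 1 {2, 4, 3, 5, 6, 7, 8, 9} = {1..9::nat}" by auto
  ultimately have base: "has_cycles3 ?H {1..9}" by simp
  have "has_cycles3 ?H {1..k}" if "9 \<le> k" "k \<le> n" for k
    using that
  proof (induction k rule: dec_induct)
    case base
    show ?case by fact
  next
    case (step k)
    \<comment> \<open>The edge from \<open>k\<close> to \<open>k + 1\<close> carries label 3 or 4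
      according to the parity of \<open>k\<close>; both generators fix the auxiliary points 4 and
      5.\<close>
    let ?r = "if even k then r3 else r4"
    have "?r 5 = 5" "?r 4 = 4" "?r k = Suc k" using step even_n by (auto simp: r_apply)
    moreover have "has_cycles3 ?H {1..k}" using step by simp
    ultimately have "has_cycles3 ?H (insert (Suc k) {1..k})"
      by (intro has_cycles3_extend[of _ _ ?r 4 5 k]) (use r_r step in auto)
    moreover have "insert (Suc k) {1..k} = {1..Suc k}" by auto
    ultimately show ?case by simp
  qed
  then show ?thesis using n_ge by simp
qed

lemma span_all: "comp_span {r0, r1, r2, r3, r4} = {p. p permutes {1..n} \<and> evenperm p}"
proof (intro equalityI subsetI)
  fix p assume "p \<in> comp_span {r0, r1, r2, r3, r4}"
  then show "p \<in> {p. p permutes {1..n} \<and> evenperm p}" using span_even by auto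
next
  fix p assume "p \<in> {p. p permutes {1..n} \<and> evenperm p}"
  then show "p \<in> comp_span {r0, r1, r2, r3, r4}"
    using even_permutation_in_span[OF has_cycles3_all r_involution[OF order_refl]] by blast
qed

section \<open>Subgroups generated by some of the generators\<close>

lemma omit0_preserves: "g \<in> comp_span {r1, r2, r3, r4} \<Longrightarrow> x \<in> {1..4} \<Longrightarrow> g x \<in> {1..4}"
  by (erule span_invariant) (auto simp: r_apply)

lemma omit1_preserves: "g \<in> comp_span {r0, r2, r3, r4} \<Longrightarrow> x \<in> {1, 2} \<Longrightarrow> g x \<in> {1, 2}"
  by (erule span_invariant) (auto simp: r_apply)

lemma omit2_preserves: "g \<in> comp_span {r0, r1, r3, r4} \<Longrightarrow> x \<le> 7 \<Longrightarrow> g x \<le> 7"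
  unfolding atMost_iff[symmetric] by (erule span_invariant) (auto simp: r_apply)

lemma omit3_preserves: "g \<in> comp_span {r0, r1, r2, r4} \<Longrightarrow> x \<le> 8 \<Longrightarrow> g x \<le> 8"
  unfolding atMost_iff[symmetric] by (erule span_invariant) (auto simp: r_apply)

lemma omit4_preserves:
  assumes "g \<in> comp_span {r0, r1, r2, r3}" "x \<le> 9"
  shows "g x \<le> 9"
proof -
  have r3: "r3 y \<le> 9" if "y \<le> 9" for y
  proof (cases "y = 8 \<or> y = 9")
    case False
    then show ?thesis using that by (simp add: r3_less)
  qed (auto simp: r3_apply)
  have "s y \<in> {..9}" if "s \<in> {r0, r1, r2, r3}" "y \<in> {..9}" for s y
    using that r3[of y] by (elim insertE emptyE) (simp_all add: r0_apply r1_apply r2_apply)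
  then have "g x \<in> {..9}"
    using assms(2) by (intro span_invariant[OF assms(1), of x "{..9}"]) simp_all
  then show ?thesis by simp
qed

text \<open>Among these generators only \<open>r4\<close> moves points from 9 on.\<close>

lemma omit3_acts:
  assumes "g \<in> comp_span {r0, r1, r2, r4}"
  shows "(\<forall>x\<ge>9. g x = x) \<or> (\<forall>x\<ge>9. g x = r4 x)"
proof -
  have "(\<forall>x\<in>{9..}. g x = x) \<or> (\<forall>x\<in>{9..}. g x = r4 x)"
    using assms by (rule span_acts_on) (use r4_ge r4_r4 in \<open>auto simp: r0_apply r1_apply r2_apply\<close>)
  then show ?thesis by auto
qed

lemma omit4_acts:
  assumes "g \<in> comp_span {r0, r1, r2, r3}"
  shows "(\<forall>x\<ge>10. g x = x) \<or> (\<forall>x\<ge>10. g x = r3 x)"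
proof -
  have "(\<forall>x\<in>{10..}. g x = x) \<or> (\<forall>x\<in>{10..}. g x = r3 x)"
    using assms by (rule span_acts_on) (use r3_ge r3_r3 in \<open>auto simp: r0_apply r1_apply r2_apply\<close>)
  then show ?thesis by auto
qed

lemma span_r2_r3_r4_acts:
  assumes "g \<in> comp_span {r2, r3, r4}"
  shows "(\<forall>x\<le>6. g x = x) \<or> (\<forall>x\<le>6. g x = r2 x)"
proof -
  have "(\<forall>x\<in>{..6}. g x = x) \<or> (\<forall>x\<in>{..6}. g x = r2 x)"
    using assms by (rule span_acts_on) (use r2_r2 in \<open>auto simp: r_apply\<close>)
  then show ?thesis by auto
qed

text \<open>\<open>r3\<close> and \<open>r4\<close> fix the invariant set \<open>{1..4}\<close>
  pointwise, so deleting them from a word does not change its action there.\<close>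

lemma omit0_acts:
  assumes "g \<in> comp_span {r1, r2, r3, r4}"
  shows "\<exists>h \<in> comp_span {r1, r2}. \<forall>x\<in>{1..4}. g x = h x"
  using assms
proof induction
  case span_id
  show ?case using comp_span.span_id by fastforce
next
  case (span_step s g)
  then obtain h where h: "h \<in> comp_span {r1, r2}" "\<forall>x\<in>{1..4}. g x = h x" by blast
  show ?case
  proof (cases "s \<in> {r1, r2}")
    case True
    then show ?thesis using h by (intro bexI[of _ "s \<circ> h"]) (auto intro: comp_span.span_step)
  next
    case False
    then have "s \<in> {r3, r4}" using span_step by blast
    then have "s y = y" if "y \<in> {1..4}" for y using that by (auto simp: r3_less r4_less)
    then show ?thesis using h omit0_preserves[OF span_step.hyps(2)] by auto
  qed
qed

section \<open>The symmetric group of degree three generated by \<open>r0\<close> and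
  \<open>r1\<close>\<close>

lemma r0_r1_braid: "r1 \<circ> r0 \<circ> r1 = r0 \<circ> r1 \<circ> r0"
proof
  fix x
  show "(r1 \<circ> r0 \<circ> r1) x = (r0 \<circ> r1 \<circ> r0) x"
  proof (cases "x \<in> {2, 3, 4, 5, 6, 7}")
    case True
    then show ?thesis by (elim insertE emptyE) (simp_all add: r0_apply r1_apply)
  qed (simp add: r0_apply r1_apply)
qed

text \<open>The braid relation makes the list of six words closed under left multiplication.\<close>

lemma span_r0_r1:
  assumes "g \<in> comp_span {r0, r1}"
  shows "g \<in> {id, r0, r1, r0 \<circ> r1, r1 \<circ> r0, r0 \<circ> r1 \<circ> r0}"
  using assms
proof induction
  case (span_step s g)
  have cancel: "r0 \<circ> (r0 \<circ> h) = h" "r1 \<circ> (r1 \<circ> h) = h" for h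
    by (simp_all add: comp_assoc[symmetric] r_r)
  have braid: "r1 \<circ> (r0 \<circ> r1) = r0 \<circ> (r1 \<circ> r0)" using r0_r1_braid by (simp add: comp_assoc)
  have braid': "r1 \<circ> (r0 \<circ> (r1 \<circ> r0)) = r0 \<circ> r1"
    unfolding braid[symmetric] cancel ..
  consider "s = r0" | "s = r1" using span_step.hyps(1) by blast
  then show ?case
    by cases (use span_step.IH in \<open>elim insertE emptyE;
      simp only: comp_assoc cancel braid braid' r_r comp_id insert_iff simp_thms\<close>)+
qed simp

text \<open>Each of the other four words sends 2 or 3 to 5, out of the invariant set
  \<open>{1..4}\<close>.\<close>

lemma span_r0_r1_omit0:
  assumes "g \<in> comp_span {r0, r1}" "g \<in> comp_span {r1, r2, r3, r4}"
  shows "g = id \<or> g = r1"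
proof -
  have "g 2 \<le> 4" "g 3 \<le> 4" using omit0_preserves[OF assms(2), of 2] omit0_preserves[OF assms(2), of 3] by auto
  then show ?thesis using span_r0_r1[OF assms(1)]
    by (elim insertE emptyE) (simp_all add: r0_apply r1_apply)
qed

lemma span_r0_r1_omit1:
  assumes "g \<in> comp_span {r0, r1}" "g \<in> comp_span {r0, r2, r3, r4}"
  shows "g = id \<or> g = r0"
proof -
  have "g 2 \<in> {1, 2}" using omit1_preserves[OF assms(2), of 2] by auto
  then show ?thesis using span_r0_r1[OF assms(1)]
    by (elim insertE emptyE) (simp_all add: r0_apply r1_apply)
qed

section \<open>The dihedral group generated by \<open>r3\<close> and \<open>r4\<close>\<close>

text \<open>
  Following the path \<open>8 - 9 - \<dots> - n\<close>, the cycle \<open>\<rho>\<^sub>3 \<rho>\<^sub>4\<close> runs \<open>8, 9, 11, \<dots>, n - 1, n, n - 2, \<dots>, 10\<close>;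
  \<open>q\<close> is the position modulo \<open>n - 7\<close> on this cycle, on which \<open>\<rho>\<^sub>3\<close> and \<open>\<rho>\<^sub>4\<close> act as the
  reflections \<open>t \<mapsto> 1 - t\<close> and \<open>t \<mapsto> - t\<close>.
\<close>

definition q :: "nat \<Rightarrow> int" where
  "q x = (if odd x then (int x - 7) div 2 else - ((int x - 8) div 2))"

text \<open>On \<open>{8..n}\<close> the values of \<open>q\<close> lie between
  \<open>-(n - 8) / 2\<close> and \<open>(n - 8) / 2\<close>, so two of them differ by less than the
  modulus \<open>n - 7\<close>.\<close>

lemma q_inj:
  assumes "x \<in> {8..n}" "y \<in> {8..n}" "int (n - 7) dvd q x - q y"
  shows "x = y"
proof -
  have "\<bar>q x - q y\<bar> < int (n - 7)"
    using assms(1,2) even_n n_ge by (auto simp: q_def elim!: evenE oddE)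
  then have "q x = q y" using dvd_imp_le_int[OF _ assms(3)] by force
  then show ?thesis using assms(1,2) by (auto simp: q_def elim!: evenE oddE split: if_splits)
qed

lemma q_r3:
  assumes "x \<in> {8..n}"
  shows "r3 x \<in> {8..n}" "int (n - 7) dvd q (r3 x) + q x - 1"
proof -
  show "r3 x \<in> {8..n}" using assms even_n r3_ge[of 8 x] by (auto simp: r3_apply)
  show "int (n - 7) dvd q (r3 x) + q x - 1"
  \<comment> \<open>\<open>r3\<close> fixes the end \<open>n\<close> of the path. There the
    reflection formula holds only modulo \<open>n - 7\<close>, since
    \<open>2 * q n - 1 = -(n - 7)\<close>; elsewhere it is an equality.\<close>
  proof (cases "x = n")
    case True
    then have "q (r3 x) + q x - 1 = - int (n - 7)"
      using even_n n_ge by (auto simp: q_def r3_apply elim!: evenE)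
    then show ?thesis by simp
  next
    case False
    then have "q (r3 x) + q x - 1 = 0"
      using assms by (cases "even x") (auto simp: q_def r3_apply elim!: evenE oddE)
    then show ?thesis by simp
  qed
qed

lemma q_r4:
  assumes "x \<in> {8..n}"
  shows "r4 x \<in> {8..n}" "q (r4 x) = - q x"
proof -
  show "r4 x \<in> {8..n}" using assms even_n r4_ge[of 8 x] by (auto simp: r4_apply; presburger)
  show "q (r4 x) = - q x"
    using assms by (cases "even x"; cases "x = 8") (auto simp: q_def r4_apply elim!: evenE oddE)
qed

text \<open>In the coordinate \<open>q\<close> every element is an affine map with slope 1 or -1. A
  generator acts as a reflection \<open>y \<mapsto> c - y\<close>, so prepending it flips the slope
  and replaces \<open>t\<close> by \<open>c - t\<close>.\<close>

lemma span_r3_r4: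
  assumes "g \<in> comp_span {r3, r4}"
  shows "(\<forall>x\<in>{8..n}. g x \<in> {8..n}) \<and>
    (\<exists>t. (\<forall>x\<in>{8..n}. int (n - 7) dvd q (g x) - q x - t) \<or> (\<forall>x\<in>{8..n}. int (n - 7) dvd q (g x) + q x - t))"
  using assms
proof induction
  case (span_step s g)
  let ?m = "int (n - 7)"
  have pres: "\<forall>x\<in>{8..n}. (s \<circ> g) x \<in> {8..n}"
    using span_step q_r3(1) q_r4(1) by auto
  obtain c where c: "?m dvd q (s y) + q y - c" if "y \<in> {8..n}" for y
  proof (cases "s = r3")
    case True
    then show ?thesis using that[of 1] q_r3(2) by blast
  next
    case False
    then show ?thesis using that[of 0] q_r4(2) span_step.hyps(1) by simp
  qed
  have c': "?m dvd q (s (g x)) + q (g x) - c" if "x \<in> {8..n}" for x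
    using that c span_step.IH by blast
  obtain t where t: "(\<forall>x\<in>{8..n}. ?m dvd q (g x) - q x - t) \<or> (\<forall>x\<in>{8..n}. ?m dvd q (g x) + q x - t)"
    using span_step.IH by blast
  have 1: "?m dvd q ((s \<circ> g) x) + q x - (c - t)" if "x \<in> {8..n}" "?m dvd q (g x) - q x - t" for x
    using dvd_diff[OF c'[OF that(1)] that(2)] by (simp add: algebra_simps)
  have 2: "?m dvd q ((s \<circ> g) x) - q x - (c - t)" if "x \<in> {8..n}" "?m dvd q (g x) + q x - t" for x
    using dvd_diff[OF c'[OF that(1)] that(2)] by (simp add: algebra_simps)
  from t 1 2 pres show ?case by blast
qed (auto intro!: exI[of _ 0])

lemma span_r3_r4_outside:
  assumes "g \<in> comp_span {r3, r4}" "x \<notin> {8..n}"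
  shows "g x = x"
  using assms by induction (auto simp: r3_apply r4_apply)

text \<open>Since \<open>q 8 = 0\<close>, fixing 8 forces the translation part to vanish; what
  remains is the identity or the negation, which is \<open>r4\<close>.\<close>

lemma span_r3_r4_fix:
  assumes "g \<in> comp_span {r3, r4}" "g 8 = 8"
  shows "g = id \<or> g = r4"
proof -
  let ?m = "int (n - 7)"
  have pres: "g x \<in> {8..n}" if "x \<in> {8..n}" for x using that span_r3_r4[OF assms(1)] by blast
  have out: "g x = x" "r4 x = x" if "x \<notin> {8..n}" for x
    using that span_r3_r4_outside[OF assms(1)] by (auto simp: r4_apply)
  obtain t where t: "(\<forall>x\<in>{8..n}. ?m dvd q (g x) - q x - t) \<or> (\<forall>x\<in>{8..n}. ?m dvd q (g x) + q x - t)"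
    using span_r3_r4[OF assms(1)] by blast
  have "q 8 = 0" "8 \<in> {8..n}" using n_ge by (simp_all add: q_def)
  then have m: "?m dvd t" using t assms(2) by (metis add_0 diff_0 diff_self dvd_minus_iff)
  from t show ?thesis
  proof
    assume "\<forall>x\<in>{8..n}. ?m dvd q (g x) - q x - t"
    then have "?m dvd q (g x) - q x" if "x \<in> {8..n}" for x
      using that m dvd_add[of ?m "q (g x) - q x - t" t] by simp
    then have "g x = x" for x using out q_inj pres by blast
    then show ?thesis by auto
  next
    assume "\<forall>x\<in>{8..n}. ?m dvd q (g x) + q x - t"
    then have "?m dvd q (g x) + q x" if "x \<in> {8..n}" for x
      using that m dvd_add[of ?m "q (g x) + q x - t" t] by simp
    then have "?m dvd q (g x) - q (r4 x)" if "x \<in> {8..n}" for x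
      using that q_r4(2)[OF that] by simp
    then have "g x = r4 x" for x using out q_inj pres q_r4(1) by metis
    then show ?thesis by auto
  qed
qed

lemma span_r3_r4_omit3:
  assumes "g \<in> comp_span {r3, r4}" "g \<in> comp_span {r0, r1, r2, r4}"
  shows "g = id \<or> g = r4"
proof -
  have "g 8 \<in> {8..n}" using span_r3_r4[OF assms(1)] n_ge by auto
  moreover have "g 8 \<le> 8" using omit3_preserves[OF assms(2)] by simp
  ultimately show ?thesis using span_r3_r4_fix[OF assms(1)] by simp
qed

lemma span_r3_r4_omit4:
  assumes "g \<in> comp_span {r3, r4}" "g \<in> comp_span {r0, r1, r2, r3}"
  shows "g = id \<or> g = r3"
proof -
  have "g 8 \<in> {8..n}" using span_r3_r4[OF assms(1)] n_ge by auto
  moreover have "g 8 \<le> 9" "g 9 \<le> 9" using omit4_preserves[OF assms(2)] by simp_all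
  ultimately consider "g 8 = 8" | "g 8 = 9" by fastforce
  then show ?thesis
  proof cases
    case 1
    then have "g = id \<or> g = r4" using span_r3_r4_fix[OF assms(1)] by simp
    then show ?thesis using \<open>g 9 \<le> 9\<close> n_ge by (auto simp: r4_apply)
  next
    case 2
    \<comment> \<open>Now \<open>r3 \<circ> g\<close> fixes 8, so the stabilizer result applies to
      it; the candidate \<open>r3 \<circ> r4\<close> is excluded because it sends 9 to 11.\<close>
    have inv: "r3 \<circ> (r3 \<circ> g) = g" by (simp add: comp_assoc[symmetric] r_r)
    have "r3 \<circ> g \<in> comp_span {r3, r4}" using assms(1) by (intro comp_span.span_step) auto
    moreover have "(r3 \<circ> g) 8 = 8" using 2 n_ge by (simp add: r3_apply)
    ultimately have "r3 \<circ> g = id \<or> r3 \<circ> g = r4" using span_r3_r4_fix by blast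
    then have "g = r3 \<or> g = r3 \<circ> r4" using inv by (metis comp_id)
    moreover have "(r3 \<circ> r4) 9 = 11" using n_ge by (simp add: r3_apply r4_apply)
    ultimately show ?thesis using \<open>g 9 \<le> 9\<close> by auto
  qed
qed

text \<open>The two reflections compose to the translation by 1.\<close>

lemma r3_comp_r4_funpow:
  assumes "x \<in> {8..n}"
  shows "((r3 \<circ> r4) ^^ k) x \<in> {8..n} \<and> int (n - 7) dvd q (((r3 \<circ> r4) ^^ k) x) - q x - int k"
proof (induction k)
  case (Suc k)
  let ?m = "int (n - 7)" and ?y = "((r3 \<circ> r4) ^^ k) x"
  have y: "?y \<in> {8..n}" "?m dvd q ?y - q x - int k" using Suc by blast+
  have r4y: "r4 ?y \<in> {8..n}" using q_r4(1) y(1) by blast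
  have "?m dvd q (r3 (r4 ?y)) - q ?y - 1"
    using q_r3(2)[OF r4y] q_r4(2)[OF y(1)] by simp
  then have "?m dvd q (r3 (r4 ?y)) - q x - int (Suc k)"
    using dvd_add[OF _ y(2)] by (fastforce simp: algebra_simps)
  moreover have "((r3 \<circ> r4) ^^ Suc k) x = r3 (r4 ?y)" by simp
  ultimately show ?case using q_r3(1)[OF r4y] by metis
qed (use assms in simp)

lemma r3_comp_r4_funpow_eq_id: "(r3 \<circ> r4) ^^ k = id \<longleftrightarrow> n - 7 dvd k"
proof
  assume "(r3 \<circ> r4) ^^ k = id"
  then have "int (n - 7) dvd int k"
    using r3_comp_r4_funpow[of 8 k] n_ge by simp
  then show "n - 7 dvd k" by simp
next
  assume k: "n - 7 dvd k"
  then have dvd: "int (n - 7) dvd int k" by simp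
  show "(r3 \<circ> r4) ^^ k = id"
  proof
    fix x
    show "((r3 \<circ> r4) ^^ k) x = id x"
    proof (cases "x \<in> {8..n}")
      case True
      have "int (n - 7) dvd q (((r3 \<circ> r4) ^^ k) x) - q x"
        using dvd_add[OF conjunct2[OF r3_comp_r4_funpow[OF True, of k]] dvd] by simp
      then show ?thesis using q_inj r3_comp_r4_funpow[OF True, of k] True by simp
    next
      case False
      have "((r3 \<circ> r4) ^^ k) x = x"
        by (induction k) (use False in \<open>auto simp: r3_apply r4_apply\<close>)
      then show ?thesis by simp
    qed
  qed
qed

section \<open>Intersections with subgroups omitting an index\<close>

lemma span_supported:
  assumes "g \<in> comp_span S" "S \<subseteq> {r0, r1, r2, r3, r4}" "\<And>x. x \<notin> A \<Longrightarrow> g x = x"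
  shows "g permutes A"
  using permutes_superset[OF span_even(1)[OF assms(1,2)]] assms(3) by blast

text \<open>A factor \<open>r2\<close> corrects \<open>g\<close> on the points up to 6, and a factor
  \<open>r4\<close> on those from 9 on. The rest is an even permutation of \<open>{7, 8}\<close>,
  hence the identity.\<close>

lemma span_r2_r3_r4_omit3:
  assumes g: "g \<in> comp_span {r2, r3, r4}" and g': "g \<in> comp_span {r0, r1, r2, r4}"
  shows "g \<in> comp_span {r2, r4}"
proof -
  obtain a where a: "a = id \<or> a = r2" "\<And>x. x \<le> 6 \<Longrightarrow> a (g x) = x"
    using acts_on_correction[of "{..6}" g r2] span_r2_r3_r4_acts[OF g] r2_r2 by auto
  obtain c where c: "c = id \<or> c = r4" "\<And>x. 9 \<le> x \<Longrightarrow> c (g x) = x"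
    using acts_on_correction[of "{9..}" g r4] omit3_acts[OF g'] r4_r4 by auto
  let ?h = "c \<circ> (a \<circ> g)"
  have low: "?h x = x" if "x \<le> 6" for x
    using that a(2) c(1) by (auto simp: r4_less)
  have high: "?h x = x" if "9 \<le> x" for x
  proof -
    have "9 \<le> g x" using omit3_acts[OF g'] that r4_ge[of 9 x] by auto
    then have "a (g x) = g x" using a(1) by (auto simp: r2_apply)
    then show ?thesis using c(2) that by simp
  qed
  have h: "?h \<in> comp_span {r2, r3, r4}"
    using a(1) c(1) g by (intro span_comp) (auto intro: span_base comp_span.span_id)
  have "?h x = x" if "x \<notin> {7, 8}" for x
    using that low[of x] high[of x] by (cases "x \<le> 6") (simp_all only:, force)
  then have "?h permutes {7, 8}" using h by (intro span_supported[OF h]) auto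
  moreover have "evenperm ?h" using h by (rule span_even) auto
  ultimately have "?h = id" by (auto simp: permutes_doubleton_iff evenperm_swap)
  then have "?h \<in> comp_span {r2, r4}" by (simp only: comp_span.span_id)
  moreover have "a \<in> comp_span {r2, r4}" "c \<in> comp_span {r2, r4}"
    using a(1) c(1) comp_span.span_id by (auto intro: span_base)
  moreover have "s \<circ> s = id" if "s \<in> {r2, r4}" for s using that r_r by auto
  ultimately show ?thesis using span_cancel_left by metis
qed

text \<open>Corrections by \<open>r2\<close> and \<open>r3\<close> leave an even permutation of
  \<open>{7, 8, 9}\<close>, and \<open>r2\<close>, \<open>r3\<close> generate all of these.\<close>

lemma span_r2_r3_r4_omit4:
  assumes g: "g \<in> comp_span {r2, r3, r4}" and g': "g \<in> comp_span {r0, r1, r2, r3}"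
  shows "g \<in> comp_span {r2, r3}"
proof -
  obtain a where a: "a = id \<or> a = r2" "\<And>x. x \<le> 6 \<Longrightarrow> a (g x) = x"
    using acts_on_correction[of "{..6}" g r2] span_r2_r3_r4_acts[OF g] r2_r2 by auto
  obtain c where c: "c = id \<or> c = r3" "\<And>x. 10 \<le> x \<Longrightarrow> c (g x) = x"
    using acts_on_correction[of "{10..}" g r3] omit4_acts[OF g'] r3_r3 by auto
  let ?h = "c \<circ> (a \<circ> g)"
  have low: "?h x = x" if "x \<le> 6" for x
    using that a(2) c(1) by (auto simp: r3_less)
  have high: "?h x = x" if "10 \<le> x" for x
  proof -
    have "10 \<le> g x" using omit4_acts[OF g'] that r3_ge[of 10 x] by auto
    then have "a (g x) = g x" using a(1) by (auto simp: r2_apply)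
    then show ?thesis using c(2) that by simp
  qed
  have h: "?h \<in> comp_span {r2, r3, r4}"
    using a(1) c(1) g by (intro span_comp) (auto intro: span_base comp_span.span_id)
  have "?h x = x" if "x \<notin> {7, 8, 9}" for x
    using that low[of x] high[of x] by (cases "x \<le> 6") (simp_all only:, force)
  then have "?h permutes {7, 8, 9}" using h by (intro span_supported[OF h]) auto
  moreover have "evenperm ?h" using h by (rule span_even) auto
  moreover have inv: "s \<circ> s = id" if "s \<in> {r2, r3}" for s using that r_r by auto
  ultimately have "?h \<in> comp_span {r2, r3}"
    using even_permutation_in_span[OF has_cycles3_789[of "{r2, r3}"]] by blast
  moreover have "a \<in> comp_span {r2, r3}" "c \<in> comp_span {r2, r3}"
    using a(1) c(1) comp_span.span_id by (auto intro: span_base)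
  ultimately show ?thesis using span_cancel_left inv by metis
qed

text \<open>The action on \<open>{1..4}\<close> is undone inside \<open>comp_span {r1, r2}\<close>,
  and the action from 10 on by \<open>r3\<close> if necessary. The rest is an even permutation of
  \<open>{5, 6, 7, 8, 9}\<close>, all of which \<open>r1\<close>, \<open>r2\<close>,
  \<open>r3\<close> generate.\<close>

lemma omit0_omit4:
  assumes g: "g \<in> comp_span {r1, r2, r3, r4}" and g': "g \<in> comp_span {r0, r1, r2, r3}"
  shows "g \<in> comp_span {r1, r2, r3}"
proof -
  have inv: "s \<circ> s = id" if "s \<in> {r1, r2, r3}" for s using that r_r by auto
  obtain c where c: "c = id \<or> c = r3" "\<And>x. 10 \<le> x \<Longrightarrow> c (g x) = x"
    using acts_on_correction[of "{10..}" g r3] omit4_acts[OF g'] r3_r3 by auto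
  obtain h where h: "h \<in> comp_span {r1, r2}" "\<And>x. x \<in> {1..4} \<Longrightarrow> g x = h x"
    using omit0_acts[OF g] by blast
  obtain k where k: "k \<in> comp_span {r1, r2}" "k \<circ> h = id"
    using span_inverse[OF _ h(1)] r_r by (metis insertE singletonD)
  have kk: "k \<in> comp_span {r1, r2, r3}" using k(1) by (rule span_mono) auto
  have cc: "c \<in> comp_span {r1, r2, r3}" using c(1) by (auto intro: span_base comp_span.span_id)
  let ?h = "k \<circ> (c \<circ> g)"
  have h_in: "?h \<in> comp_span {r0, r1, r2, r3}"
    by (intro span_comp g' span_mono[OF kk] span_mono[OF cc]) auto
  have low: "?h x = x" if "x \<in> {1..4}" for x
  proof -
    have "g x < 8" using omit0_preserves[OF g that] by auto
    then have "c (g x) = g x" using c(1) by (auto simp: r3_less)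
    then show ?thesis using h(2)[OF that] k(2) by (metis comp_apply id_apply)
  qed
  have high: "?h x = x" if "10 \<le> x" for x
  proof -
    have "k y = y" if "y \<ge> 10" for y
      using k(1) that by (induction rule: comp_span.induct) (auto simp: r1_apply r2_apply)
    then show ?thesis using c(2) that by simp
  qed
  \<comment> \<open>The natural number 0 is not a vertex and lies in neither of the two ranges
    treated above.\<close>
  have "?h 0 = 0"
    using span_even(1)[OF h_in] by (auto simp: permutes_def)
  then have "?h x = x" if "x \<notin> {5, 6, 7, 8, 9}" for x
    using that low[of x] high[of x] by (cases "x = 0") force+
  then have "?h permutes {5, 6, 7, 8, 9}"
    using h_in by (intro span_supported[of _ "{r0, r1, r2, r3}"]) auto
  moreover have "evenperm ?h" using h_in by (rule span_even) auto
  ultimately have "?h \<in> comp_span {r1, r2, r3}"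
    using even_permutation_in_span[OF has_cycles3_56789[of "{r1, r2, r3}"] inv] by blast
  then show ?thesis using span_cancel_left[OF inv] kk cc by blast
qed

section \<open>The group of the cube generated by \<open>r0\<close>, \<open>r1\<close> and
  \<open>r2\<close>\<close>

lemma r1_r2_braid: "r2 \<circ> r1 \<circ> r2 \<circ> r1 = r1 \<circ> r2 \<circ> r1 \<circ> r2"
proof
  fix x
  show "(r2 \<circ> r1 \<circ> r2 \<circ> r1) x = (r1 \<circ> r2 \<circ> r1 \<circ> r2) x"
  proof (cases "x \<in> {1, 2, 3, 4, 5, 6, 7, 8}")
    case True
    then show ?thesis by (elim insertE emptyE) (simp_all add: r2_apply r1_apply)
  qed (simp add: r2_apply r1_apply)
qed

text \<open>
  The group generated by \<open>\<rho>\<^sub>0, \<rho>\<^sub>1, \<rho>\<^sub>2\<close> is that of the cube, and \<open>{1, 2, 3, 4}\<close> is one of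
  its six faces; the six words are representatives of the cosets of the stabilizer of that face.
\<close>

definition cosets_r1_r2 :: "(nat \<Rightarrow> nat) \<Rightarrow> (nat \<Rightarrow> nat) set" where
  "cosets_r1_r2 h = {h, r0 \<circ> h, r1 \<circ> (r0 \<circ> h), r2 \<circ> (r1 \<circ> (r0 \<circ> h)),
     r1 \<circ> (r2 \<circ> (r1 \<circ> (r0 \<circ> h))), r0 \<circ> (r1 \<circ> (r2 \<circ> (r1 \<circ> (r0 \<circ> h))))}"

text \<open>A generator in front either leads to another representative or, by the braid and
  commutation relations, passes through the word and reaches \<open>h\<close> as an inner factor
  \<open>r1\<close> or \<open>r2\<close>.\<close>

lemma cosets_r1_r2_step:
  assumes "g \<in> cosets_r1_r2 h" "s \<in> {r0, r1, r2}"
  shows "s \<circ> g \<in> cosets_r1_r2 h \<union> cosets_r1_r2 (r1 \<circ> h) \<union> cosets_r1_r2 (r2 \<circ> h)"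
proof -
  have r1_r0: "r1 \<circ> (r0 \<circ> (r1 \<circ> f)) = r0 \<circ> (r1 \<circ> (r0 \<circ> f))" for f :: "nat \<Rightarrow> nat"
    unfolding comp_assoc[symmetric] r0_r1_braid ..
  have r2_r0: "r2 \<circ> (r0 \<circ> f) = r0 \<circ> (r2 \<circ> f)" for f :: "nat \<Rightarrow> nat"
    unfolding comp_assoc[symmetric] r0_r2 ..
  have r2_r1: "r2 \<circ> (r1 \<circ> (r2 \<circ> (r1 \<circ> f))) = r1 \<circ> (r2 \<circ> (r1 \<circ> (r2 \<circ> f)))" for f :: "nat \<Rightarrow> nat"
    unfolding comp_assoc[symmetric] r1_r2_braid ..
  have cancel: "r0 \<circ> (r0 \<circ> f) = f" "r1 \<circ> (r1 \<circ> f) = f" "r2 \<circ> (r2 \<circ> f) = f" for f :: "nat \<Rightarrow> nat"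
    by (simp_all add: comp_assoc[symmetric] r_r)
  show ?thesis
    using assms unfolding cosets_r1_r2_def
    by (elim insertE emptyE) (simp_all only: cancel r1_r0 r2_r0 r2_r1 Un_iff insert_iff simp_thms)
qed

lemma span_r0_r1_r2_cosets:
  assumes "g \<in> comp_span {r0, r1, r2}"
  shows "\<exists>h \<in> comp_span {r1, r2}. g \<in> cosets_r1_r2 h"
  using assms
proof induction
  case span_id
  have "id \<in> cosets_r1_r2 id" by (simp add: cosets_r1_r2_def)
  then show ?case using comp_span.span_id by blast
next
  case (span_step s g)
  then obtain h where h: "h \<in> comp_span {r1, r2}" "g \<in> cosets_r1_r2 h" by blast
  then have "r1 \<circ> h \<in> comp_span {r1, r2}" "r2 \<circ> h \<in> comp_span {r1, r2}"
    by (simp_all add: comp_span.span_step)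
  then show ?case using cosets_r1_r2_step[OF h(2) span_step.hyps(1)] h(1) by blast
qed

text \<open>The five nontrivial representatives send 3 into \<open>{5, 6, 7}\<close>, outside the
  invariant set \<open>{1..4}\<close>. Evaluating \<open>g\<close> at the preimage
  \<open>k 3\<close> of 3 under \<open>h\<close> therefore forces \<open>g = h\<close>.\<close>

lemma span_r0_r1_r2_omit0:
  assumes "g \<in> comp_span {r0, r1, r2}" "g \<in> comp_span {r1, r2, r3, r4}"
  shows "g \<in> comp_span {r1, r2}"
proof -
  obtain h where h: "h \<in> comp_span {r1, r2}" "g \<in> cosets_r1_r2 h"
    using span_r0_r1_r2_cosets[OF assms(1)] by blast
  obtain k where k: "k \<in> comp_span {r1, r2}" "h \<circ> k = id"
    using span_inverse[OF _ h(1)] r_r by (metis insertE singletonD)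
  have hk: "h (k 3) = 3" using k(2) by (metis comp_apply id_apply)
  have "k 3 \<in> {1..4}"
    using omit0_preserves[OF span_mono[OF k(1)]] by auto
  then have "g (k 3) \<in> {1..4}" using omit0_preserves[OF assms(2)] by blast
  moreover have "g = h \<or> g (k 3) \<in> {5, 6, 7}"
    using h(2) hk by (auto simp: cosets_r1_r2_def r0_apply r1_apply r2_apply)
  ultimately show ?thesis using h(1) by auto
qed

section \<open>The intersection property\<close>

definition gen :: "nat set \<Rightarrow> (nat \<Rightarrow> nat) set" where
  "gen J = comp_span (graph_rho (thm45_edges n) ` J)"

lemma gen_omit:
  "gen ({..<5} - {0}) = comp_span {r1, r2, r3, r4}"
  "gen ({..<5} - {1}) = comp_span {r0, r2, r3, r4}"
  "gen ({..<5} - {2}) = comp_span {r0, r1, r3, r4}"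
  "gen ({..<5} - {3}) = comp_span {r0, r1, r2, r4}"
  "gen ({..<5} - {4}) = comp_span {r0, r1, r2, r3}"
proof -
  have sets: "{..<5} - {0} = {1, 2, 3, 4::nat}" "{..<5} - {1} = {0, 2, 3, 4::nat}"
    "{..<5} - {2} = {0, 1, 3, 4::nat}" "{..<5} - {3} = {0, 1, 2, 4::nat}"
    "{..<5} - {4} = {0, 1, 2, 3::nat}" by auto
  show "gen ({..<5} - {0}) = comp_span {r1, r2, r3, r4}"
    unfolding gen_def sets by (simp add: graph_rho_simps)
  show "gen ({..<5} - {1}) = comp_span {r0, r2, r3, r4}"
    unfolding gen_def sets by (simp add: graph_rho_simps)
  show "gen ({..<5} - {2}) = comp_span {r0, r1, r3, r4}"
    unfolding gen_def sets by (simp add: graph_rho_simps)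
  show "gen ({..<5} - {3}) = comp_span {r0, r1, r2, r4}"
    unfolding gen_def sets by (simp add: graph_rho_simps)
  show "gen ({..<5} - {4}) = comp_span {r0, r1, r2, r3}"
    unfolding gen_def sets by (simp add: graph_rho_simps)
qed

lemma gen_mono: "g \<in> gen J \<Longrightarrow> J \<subseteq> K \<Longrightarrow> g \<in> gen K"
  unfolding gen_def by (erule span_mono) blast

lemma graph_rho_in:
  assumes "k < 5"
  shows "graph_rho (thm45_edges n) k \<in> {r0, r1, r2, r3, r4}"
proof -
  have "k \<in> {0, 1, 2, 3, 4}" using assms by auto
  then show ?thesis by (elim insertE emptyE) (simp_all add: graph_rho_simps)
qed

lemma gen_involution:
  "J \<subseteq> {..<5} \<Longrightarrow> s \<in> graph_rho (thm45_edges n) ` J \<Longrightarrow> s \<circ> s = id"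
  using graph_rho_in by (blast intro: r_involution[OF order_refl])

lemma gen_cancel_right:
  assumes "a \<circ> b \<in> gen J" "b \<in> gen J" "J \<subseteq> {..<5}"
  shows "a \<in> gen J"
  using span_cancel_right[of "graph_rho (thm45_edges n) ` J", OF gen_involution[OF assms(3)]] assms(1,2)
  unfolding gen_def by blast

lemma gen_cancel_left:
  assumes "a \<circ> b \<in> gen J" "a \<in> gen J" "J \<subseteq> {..<5}"
  shows "b \<in> gen J"
  using span_cancel_left[of "graph_rho (thm45_edges n) ` J", OF gen_involution[OF assms(3)]] assms(1,2)
  unfolding gen_def by blast

lemma gen_comp: "a \<in> gen J \<Longrightarrow> b \<in> gen J \<Longrightarrow> a \<circ> b \<in> gen J"
  unfolding gen_def by (rule span_comp)

lemma id_in_gen: "id \<in> gen J"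
  unfolding gen_def by (rule comp_span.span_id)

lemma gen_split:
  assumes "g \<in> gen (A \<union> B)" and "\<And>i j. i \<in> A \<Longrightarrow> j \<in> B \<Longrightarrow> i + 2 \<le> j" "B \<subseteq> {..<5}"
  obtains a b where "a \<in> gen A" "b \<in> gen B" "g = a \<circ> b"
proof -
  have "s \<circ> t = t \<circ> s" if st: "s \<in> graph_rho (thm45_edges n) ` A" "t \<in> graph_rho (thm45_edges n) ` B" for s t
  proof -
    obtain i j where ij: "i \<in> A" "j \<in> B" and st: "s = graph_rho (thm45_edges n) i" "t = graph_rho (thm45_edges n) j"
      using st by blast
    have "(i, j) \<in> {(0, 2), (0, 3), (0, 4), (1, 3), (1, 4), (2, 4)}"
      using assms(2)[OF ij] assms(3) ij(2) by auto
    then show ?thesis unfolding st using r_commute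
      by (elim insertE emptyE) (simp_all add: graph_rho_simps)
  qed
  then show thesis using that span_Un_commuting assms(1) unfolding gen_def image_Un by metis
qed

text \<open>A factor whose index set avoids \<open>k\<close> already lies in the subgroup omitting
  \<open>k\<close>, so it can be cancelled from \<open>g\<close>.\<close>

lemma gen_factor_omitting:
  assumes "g \<in> gen ({..<5} - {k})" "g = a \<circ> b" "a \<in> gen A" "b \<in> gen B"
    and "A \<subseteq> {..<5}" "B \<subseteq> {..<5}"
  shows "k \<notin> B \<Longrightarrow> a \<in> gen ({..<5} - {k})" "k \<notin> A \<Longrightarrow> b \<in> gen ({..<5} - {k})"
proof -
  show "a \<in> gen ({..<5} - {k})" if "k \<notin> B"
    using assms(1,2) by (rule_tac gen_cancel_right[of a b]) (use assms(6) that in \<open>auto intro: gen_mono[OF assms(4)]\<close>)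
  show "b \<in> gen ({..<5} - {k})" if "k \<notin> A"
    using assms(1,2) by (rule_tac gen_cancel_left[of a b]) (use assms(5) that in \<open>auto intro: gen_mono[OF assms(3)]\<close>)
qed

text \<open>Each generator breaks the vertex set that all the others preserve.\<close>

lemma graph_rho_notin_omit:
  assumes "k < 5"
  shows "graph_rho (thm45_edges n) k \<notin> gen ({..<5} - {k})"
proof -
  have "r0 \<notin> comp_span {r1, r2, r3, r4}" using omit0_preserves[of r0 3] by (auto simp: r0_apply)
  moreover have "r1 \<notin> comp_span {r0, r2, r3, r4}" using omit1_preserves[of r1 2] by (auto simp: r1_apply)
  moreover have "r2 \<notin> comp_span {r0, r1, r3, r4}" using omit2_preserves[of r2 7] by (auto simp: r2_apply)
  moreover have "r3 \<notin> comp_span {r0, r1, r2, r4}" using omit3_preserves[of r3 8] n_ge by (auto simp: r3_apply)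
  moreover have "r4 \<notin> comp_span {r0, r1, r2, r3}" using omit4_preserves[of r4 9] n_ge by (auto simp: r4_apply)
  moreover have "k \<in> {0, 1, 2, 3, 4}" using assms by auto
  ultimately show ?thesis
    by (elim insertE emptyE) (simp_all add: gen_omit gen_omit(2)[simplified] graph_rho_simps)
qed

section \<open>From small blocks of indices to the full intersection criterion\<close>

lemma gen_singleton_cases:
  assumes "g \<in> gen {k}" "k < 5" "k \<notin> J \<Longrightarrow> g \<in> gen ({..<5} - {k})"
  shows "g \<in> gen J"
proof (cases "k \<in> J")
  case True
  then show ?thesis using assms(1) by (auto intro: gen_mono)
next
  case False
  have "graph_rho (thm45_edges n) k \<circ> graph_rho (thm45_edges n) k = id"
    using gen_involution[of "{k}"] assms(2) by simp
  then have "g = id \<or> g = graph_rho (thm45_edges n) k"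
    using span_singleton assms(1) unfolding gen_def by fastforce
  then show ?thesis
    using graph_rho_notin_omit[OF assms(2)] assms(3)[OF False] id_in_gen by metis
qed

lemma gen_eq_span:
  "gen {0, 1} = comp_span {r0, r1}" "gen {3, 4} = comp_span {r3, r4}" "gen {2, 3, 4} = comp_span {r2, r3, r4}"
  "gen {2, 4} = comp_span {r2, r4}" "gen {2, 3} = comp_span {r2, r3}" "gen {0, 1, 2} = comp_span {r0, r1, r2}"
  "gen {1, 2} = comp_span {r1, r2}" "gen {1, 2, 3} = comp_span {r1, r2, r3}"
  unfolding gen_def by (simp_all add: graph_rho_simps)

lemma graph_rho_in_gen: "k \<in> J \<Longrightarrow> graph_rho (thm45_edges n) k \<in> gen J"
  unfolding gen_def by (intro span_base imageI)

lemma gen_01_cases: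
  assumes "g \<in> gen {0, 1}" "\<And>k. k \<in> {0, 1} \<Longrightarrow> k \<notin> J \<Longrightarrow> g \<in> gen ({..<5} - {k})"
  shows "g \<in> gen J"
proof -
  have g: "g \<in> comp_span {r0, r1}" using assms(1) by (simp only: gen_eq_span)
  have 0: "g = id \<or> g = graph_rho (thm45_edges n) 1" if "0 \<notin> J"
    using span_r0_r1_omit0[OF g] assms(2)[OF _ that] graph_rho_1 by (simp add: gen_omit(1))
  have 1: "g = id \<or> g = graph_rho (thm45_edges n) 0" if "1 \<notin> J"
    using span_r0_r1_omit1[OF g] assms(2)[OF _ that] graph_rho_0 by (simp add: gen_omit(2)[simplified])
  consider "0 \<in> J" "1 \<in> J" | "0 \<notin> J" "1 \<in> J" | "1 \<notin> J" "0 \<in> J" | "0 \<notin> J" "1 \<notin> J" by blast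
  then show ?thesis
  proof cases
    case 1
    then show ?thesis using assms(1) by (auto intro: gen_mono)
  next
    case 2
    then show ?thesis using 0 id_in_gen graph_rho_in_gen by metis
  next
    case 3
    then show ?thesis using 1 id_in_gen graph_rho_in_gen by metis
  next
    case 4
    have "graph_rho (thm45_edges n) 0 \<noteq> graph_rho (thm45_edges n) 1"
      unfolding graph_rho_0 One_nat_def graph_rho_1 using r0_apply[of 3] r1_apply[of 3] by auto
    then show ?thesis using 4 0 1 id_in_gen by metis
  qed
qed

lemma gen_34_cases:
  assumes "g \<in> gen {3, 4}" "\<And>k. k \<in> {3, 4} \<Longrightarrow> k \<notin> J \<Longrightarrow> g \<in> gen ({..<5} - {k})"
  shows "g \<in> gen J"
proof -
  have g: "g \<in> comp_span {r3, r4}" using assms(1) by (simp only: gen_eq_span)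
  have 3: "g = id \<or> g = graph_rho (thm45_edges n) 4" if "3 \<notin> J"
    using span_r3_r4_omit3[OF g] assms(2)[OF _ that] graph_rho_4 by (simp add: gen_omit(4))
  have 4: "g = id \<or> g = graph_rho (thm45_edges n) 3" if "4 \<notin> J"
    using span_r3_r4_omit4[OF g] assms(2)[OF _ that] graph_rho_3 by (simp add: gen_omit(5))
  consider "3 \<in> J" "4 \<in> J" | "3 \<notin> J" "4 \<in> J" | "4 \<notin> J" "3 \<in> J" | "3 \<notin> J" "4 \<notin> J" by blast
  then show ?thesis
  proof cases
    case 1
    then show ?thesis using assms(1) by (auto intro: gen_mono)
  next
    case 2
    then show ?thesis using 3 id_in_gen graph_rho_in_gen by metis
  next
    case 3
    then show ?thesis using 4 id_in_gen graph_rho_in_gen by metis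
  next
    case c: 4
    have "r3 8 \<noteq> r4 8" using n_ge by (simp add: r3_apply r4_apply)
    then have "graph_rho (thm45_edges n) 3 \<noteq> graph_rho (thm45_edges n) 4"
      unfolding graph_rho_3 graph_rho_4 by auto
    then show ?thesis using c 3 4 id_in_gen by metis
  qed
qed

lemma gen_234_cases:
  assumes "g \<in> gen {2, 3, 4}" "2 \<in> J" "\<And>k. k \<in> {3, 4} \<Longrightarrow> k \<notin> J \<Longrightarrow> g \<in> gen ({..<5} - {k})"
  shows "g \<in> gen J"
proof -
  have g: "g \<in> comp_span {r2, r3, r4}" using assms(1) by (simp only: gen_eq_span)
  consider "3 \<in> J" "4 \<in> J" | "3 \<in> J" "4 \<notin> J" | "3 \<notin> J" by blast
  then show ?thesis
  proof cases
    case 1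
    then show ?thesis using assms(1,2) by (auto intro: gen_mono)
  next
    case 2
    then have "g \<in> gen {2, 3}"
      using span_r2_r3_r4_omit4[OF g] assms(3)[of 4] by (simp add: gen_omit gen_eq_span)
    then show ?thesis using 2 assms(2) by (auto intro: gen_mono)
  next
    case 3
    \<comment> \<open>Once 3 is dropped, the indices 2 and 4 give commuting factors, so a possible
      absence of 4 is settled on its own factor.\<close>
    then have "g \<in> gen {2, 4}"
      using span_r2_r3_r4_omit3[OF g] assms(3)[of 3] by (simp add: gen_omit gen_eq_span)
    moreover have "{2, 4} = {2} \<union> {4::nat}" by auto
    ultimately have "g \<in> gen ({2} \<union> {4})" by (simp only:)
    then obtain a b where ab: "a \<in> gen {2}" "b \<in> gen {4}" "g = a \<circ> b" by (rule gen_split) auto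
    have "b \<in> gen ({..<5} - {4})" if "4 \<notin> J"
      using gen_factor_omitting(2)[OF assms(3)[OF _ that] ab(3,1,2)] by simp
    then have "b \<in> gen J" using gen_singleton_cases[OF ab(2)] by simp
    moreover have "a \<in> gen J" using ab(1) assms(2) by (auto intro: gen_mono)
    ultimately show ?thesis unfolding ab(3) by (intro gen_comp)
  qed
qed

text \<open>This yields the intersection property when applied to \<open>J \<inter> K\<close>: an
  index outside it is missing from \<open>J\<close> or from \<open>K\<close>, so a common element
  lies in the subgroup omitting that index.\<close>

lemma Inter_gen_omit:
  assumes J: "J \<subseteq> {..<5}" and g: "g \<in> gen {..<5}"
    and omit: "\<And>k. k < 5 \<Longrightarrow> k \<notin> J \<Longrightarrow> g \<in> gen ({..<5} - {k})"
  shows "g \<in> gen J"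
proof -
  \<comment> \<open>A missing inner index \<open>k\<close> separates the others into two commuting
    blocks, and every omission condition on \<open>g\<close> passes to the factor whose block
    contains the omitted index.\<close>
  have split: "g \<in> gen J"
    if "k < 5" "k \<notin> J" "A \<union> B = {..<5} - {k}" and far: "\<And>i j. i \<in> A \<Longrightarrow> j \<in> B \<Longrightarrow> i + 2 \<le> j"
      and A: "\<And>a. a \<in> gen A \<Longrightarrow> (\<And>k. k \<in> A \<Longrightarrow> k \<notin> J \<Longrightarrow> a \<in> gen ({..<5} - {k})) \<Longrightarrow> a \<in> gen J"
      and B: "\<And>b. b \<in> gen B \<Longrightarrow> (\<And>k. k \<in> B \<Longrightarrow> k \<notin> J \<Longrightarrow> b \<in> gen ({..<5} - {k})) \<Longrightarrow> b \<in> gen J"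
    for k A B
  proof -
    have sub: "A \<subseteq> {..<5}" "B \<subseteq> {..<5}" using that(3) by auto
    have "g \<in> gen (A \<union> B)" using omit[OF that(1,2)] that(3) by simp
    then obtain a b where ab: "a \<in> gen A" "b \<in> gen B" "g = a \<circ> b"
      by (rule gen_split) (use far sub in auto)
    have disj: "i \<notin> B" if "i \<in> A" for i using far[of i i] that by auto
    have "a \<in> gen J"
    proof (rule A[OF ab(1)])
      fix i assume i: "i \<in> A" "i \<notin> J"
      then have "i < 5" using sub by auto
      then show "a \<in> gen ({..<5} - {i})"
        using gen_factor_omitting(1)[OF omit[OF _ i(2)] ab(3,1,2) sub] disj[OF i(1)] by blast
    qed
    moreover have "b \<in> gen J"
    proof (rule B[OF ab(2)])
      fix i assume i: "i \<in> B" "i \<notin> J"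
      then have "i < 5" using sub by auto
      then show "b \<in> gen ({..<5} - {i})"
        using gen_factor_omitting(2)[OF omit[OF _ i(2)] ab(3,1,2) sub] disj i(1) by blast
    qed
    ultimately show ?thesis unfolding ab(3) by (rule gen_comp)
  qed
  \<comment> \<open>The order 2, 1, 3 of the search matters: when 1 is the missing index, 2 is known
    to lie in \<open>J\<close>, as \<open>gen_234_cases\<close> requires, and when 3 is missing,
    both 1 and 2 do. Otherwise only the ends 0 and 4 can be missing.\<close>
  consider "2 \<notin> J" | "2 \<in> J" "1 \<notin> J" | "{1, 2} \<subseteq> J" "3 \<notin> J" | "{1, 2, 3} \<subseteq> J" by blast
  then show ?thesis
  proof cases
    case 1
    show ?thesis
    proof (rule split[of 2 "{0, 1}" "{3, 4}"])
      show "a \<in> gen J" if "a \<in> gen {0, 1}" "\<And>k. k \<in> {0, 1} \<Longrightarrow> k \<notin> J \<Longrightarrow> a \<in> gen ({..<5} - {k})" for a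
        using that by (rule gen_01_cases)
      show "b \<in> gen J" if "b \<in> gen {3, 4}" "\<And>k. k \<in> {3, 4} \<Longrightarrow> k \<notin> J \<Longrightarrow> b \<in> gen ({..<5} - {k})" for b
        using that by (rule gen_34_cases)
    qed (use 1 in auto)
  next
    case 2
    show ?thesis
    proof (rule split[of 1 "{0}" "{2, 3, 4}"])
      fix b assume b: "b \<in> gen {2, 3, 4}" "\<And>k. k \<in> {2, 3, 4} \<Longrightarrow> k \<notin> J \<Longrightarrow> b \<in> gen ({..<5} - {k})"
      show "b \<in> gen J" by (rule gen_234_cases[OF b(1) 2(1) b(2)]) auto
    next
      fix a assume a: "a \<in> gen {0}" "\<And>k. k \<in> {0} \<Longrightarrow> k \<notin> J \<Longrightarrow> a \<in> gen ({..<5} - {k})"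
      show "a \<in> gen J" by (rule gen_singleton_cases[OF a(1) _ a(2)]) auto
    qed (use 2 in auto)
  next
    case 3
    show ?thesis
    proof (rule split[of 3 "{0, 1, 2}" "{4}"])
      fix b assume b: "b \<in> gen {4}" "\<And>k. k \<in> {4} \<Longrightarrow> k \<notin> J \<Longrightarrow> b \<in> gen ({..<5} - {k})"
      show "b \<in> gen J" by (rule gen_singleton_cases[OF b(1) _ b(2)]) auto
    next
      fix a assume a: "a \<in> gen {0, 1, 2}" "\<And>k. k \<in> {0, 1, 2} \<Longrightarrow> k \<notin> J \<Longrightarrow> a \<in> gen ({..<5} - {k})"
      show "a \<in> gen J"
      proof (cases "0 \<in> J")
        case True
        then show ?thesis using a(1) 3(1) by (auto intro: gen_mono)
      next
        case False
        then have "a \<in> gen {1, 2}"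
          using span_r0_r1_r2_omit0[of a] a(1) a(2)[of 0] by (simp only: gen_omit gen_eq_span insert_iff simp_thms)
        then show ?thesis using 3(1) by (auto intro: gen_mono)
      qed
    qed (use 3 in auto)
  next
    case 4
    consider "0 \<in> J" "4 \<in> J" | "0 \<notin> J" "4 \<in> J" | "0 \<in> J" "4 \<notin> J" | "0 \<notin> J" "4 \<notin> J" by blast
    then show ?thesis
    proof cases
      case 1
      then have "{..<5} \<subseteq> J" using \<open>{1, 2, 3} \<subseteq> J\<close> by (auto simp: lessThan_nat_numeral lessThan_Suc)
      then show ?thesis using g by (rule_tac gen_mono)
    next
      case 2
      then have "{..<5} - {0} \<subseteq> J" using \<open>{1, 2, 3} \<subseteq> J\<close> by (auto simp: lessThan_nat_numeral lessThan_Suc)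
      then show ?thesis using omit[of 0] 2 gen_mono by auto
    next
      case 3
      then have "{..<5} - {4} \<subseteq> J" using \<open>{1, 2, 3} \<subseteq> J\<close> by (auto simp: lessThan_nat_numeral lessThan_Suc)
      then show ?thesis using omit[of 4] 3 gen_mono by auto
    next
      case c: 4
      then have "g \<in> gen {1, 2, 3}"
        using omit0_omit4[of g] omit[of 0] omit[of 4] by (simp add: gen_omit gen_eq_span gen_eq_span[simplified])
      then show ?thesis using 4 by (auto intro: gen_mono)
    qed
  qed
qed

section \<open>Schlaefli type and conclusion\<close>

lemma r0_comp_r1_funpow: "(r0 \<circ> r1) ^^ k = id \<longleftrightarrow> 3 dvd k"
proof (rule funpow_eq_id_iff)
  have *: "(r0 \<circ> r1) ((r0 \<circ> r1) ((r0 \<circ> r1) x)) = x" for x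
  proof (cases "x \<in> {2, 3, 4, 5, 6, 7}")
    case True
    then show ?thesis by (elim insertE emptyE) (simp_all add: r0_apply r1_apply)
  qed (simp add: r0_apply r1_apply)
  then show "(r0 \<circ> r1) ^^ 3 = id" by (simp add: numeral_eq_Suc fun_eq_iff)
  fix j :: nat assume "0 < j" "j < 3"
  then have "j \<in> {1, 2}" by auto
  then have "((r0 \<circ> r1) ^^ j) 2 \<noteq> 2"
    by (elim insertE emptyE) (simp_all add: r0_apply r1_apply numeral_2_eq_2)
  then show "(r0 \<circ> r1) ^^ j \<noteq> id" by (metis id_apply)
qed simp

lemma r1_comp_r2_funpow: "(r1 \<circ> r2) ^^ k = id \<longleftrightarrow> 4 dvd k"
proof (rule funpow_eq_id_iff)
  have *: "(r1 \<circ> r2) ((r1 \<circ> r2) ((r1 \<circ> r2) ((r1 \<circ> r2) x))) = x" for x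
  proof (cases "x \<in> {1, 2, 3, 4, 5, 6, 7, 8}")
    case True
    then show ?thesis by (elim insertE emptyE) (simp_all add: r1_apply r2_apply)
  qed (simp add: r1_apply r2_apply)
  then show "(r1 \<circ> r2) ^^ 4 = id" by (simp add: numeral_eq_Suc fun_eq_iff)
  fix j :: nat assume "0 < j" "j < 4"
  then have "j \<in> {1, 2, 3}" by auto
  then have "((r1 \<circ> r2) ^^ j) 5 \<noteq> 5"
    by (elim insertE emptyE) (simp_all add: r1_apply r2_apply numeral_2_eq_2 numeral_3_eq_3)
  then show "(r1 \<circ> r2) ^^ j \<noteq> id" by (metis id_apply)
qed simp

lemma r2_comp_r3_funpow: "(r2 \<circ> r3) ^^ k = id \<longleftrightarrow> 6 dvd k"
proof (rule funpow_eq_id_iff)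
  have sq: "(r2 \<circ> r3) ^^ 2 = cycle3 7 9 8" by (simp only: r2_r3_square[symmetric] numeral_2_eq_2 funpow.simps comp_id)
  have "cycle3 7 9 8 ^^ 3 = (id :: nat \<Rightarrow> nat)"
    by (auto simp: numeral_3_eq_3 fun_eq_iff cycle3_apply)
  then show "(r2 \<circ> r3) ^^ 6 = id"
    using funpow_mult[where f = "r2 \<circ> r3" and m = 2 and n = 3] by (simp add: sq)
  fix j :: nat assume "0 < j" "j < 6"
  then have "j \<in> {1, 2, 3, 4, 5}" by auto
  moreover have plus2: "((r2 \<circ> r3) ^^ (2 + i)) x = cycle3 7 9 8 (((r2 \<circ> r3) ^^ i) x)" for i x
    by (simp only: funpow_add sq comp_apply)
  have "((r2 \<circ> r3) ^^ 1) 10 = 11" using n_ge by (simp add: r2_apply r3_apply)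
  \<comment> \<open>Odd powers swap 10 with 11, and the powers 2 and 4 move 7 along the
    3-cycle.\<close>
  then have "((r2 \<circ> r3) ^^ 1) 10 = 11" "((r2 \<circ> r3) ^^ 2) 7 = 9" "((r2 \<circ> r3) ^^ 3) 10 = 11"
    "((r2 \<circ> r3) ^^ 4) 7 = 8" "((r2 \<circ> r3) ^^ 5) 10 = 11"
    using plus2[of 1 10] plus2[of 2 7] plus2[of 3 10] by (simp_all add: sq cycle3_apply)
  ultimately have "((r2 \<circ> r3) ^^ j) 10 \<noteq> 10 \<or> ((r2 \<circ> r3) ^^ j) 7 \<noteq> 7"
    by (elim insertE emptyE) simp_all
  then show "(r2 \<circ> r3) ^^ j \<noteq> id" by (metis id_apply)
qed simp

lemma graph_rho_carrier: "k < 5 \<Longrightarrow> graph_rho (thm45_edges n) k \<in> carrier (alt_group n)"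
  using r_even r_permutes graph_rho_in by (simp only: alt_group_carrier)

lemma generate_alt_group:
  assumes "J \<subseteq> {..<5}"
  shows "generate (alt_group n) (graph_rho (thm45_edges n) ` J) = gen J"
  unfolding gen_def
  by (rule generate_eq_span[OF alt_group_is_group alt_group_mult alt_group_one])
    (use assms graph_rho_carrier in blast, rule gen_involution[OF assms])

lemma gen_all: "gen {..<5} = carrier (alt_group n)"
proof -
  have "{..<5} = {0, 1, 2, 3, 4::nat}" by auto
  then have "gen {..<5} = comp_span {r0, r1, r2, r3, r4}"
    unfolding gen_def by (simp add: graph_rho_simps)
  then show ?thesis by (simp only: span_all) (simp add: alt_group_def)
qed

text \<open>An equality of group records, so the claims about the generated group reduce to those
  about \<open>alt_group n\<close>, with the isomorphism being reflexivity.\<close>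

lemma subgroup_generated_graph_rho:
  "subgroup_generated (sym_group n) (graph_rho (thm45_edges n) ` {..<5}) = alt_group n"
proof -
  have sub: "graph_rho (thm45_edges n) ` {..<5} \<subseteq> carrier (sym_group n)"
    using graph_rho_carrier by (auto simp: alt_group_carrier sym_group_carrier)
  have "generate (sym_group n) (graph_rho (thm45_edges n) ` {..<5}) = gen {..<5}"
    unfolding gen_def
    by (rule generate_eq_span[OF sym_group_is_group sym_group_mult sym_group_one sub gen_involution[OF order_refl]])
  then show ?thesis
    using gen_all sub by (simp add: subgroup_generated_def Int_absorb1 alt_group_def)
qed

lemma string_C_group_alt: "string_C_group (alt_group n) (graph_rho (thm45_edges n)) 5"
  unfolding string_C_group_def
proof
  let ?rho = "graph_rho (thm45_edges n)"
  have nontriv: "?rho i \<noteq> id" if "i < 5" for i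
    using graph_rho_notin_omit[OF that] id_in_gen by metis
  have inv: "?rho i \<circ> ?rho i = id" if "i < 5" for i
    using gen_involution[of "{i}"] that by simp
  have comm: "?rho i \<circ> ?rho j = ?rho j \<circ> ?rho i" if "i + 2 \<le> j" "j < 5" for i j
  proof -
    have "(i, j) \<in> {(0, 2), (0, 3), (0, 4), (1, 3), (1, 4), (2, 4)}"
      using that by auto
    then show ?thesis using r_commute
      by (elim insertE emptyE) (simp_all add: graph_rho_simps)
  qed
  have sq: "(?rho i \<circ> ?rho j) ^^ 2 = id" if "i < 5" "j < 5" "i + 2 \<le> j \<or> j + 2 \<le> i" for i j
  proof -
    have c: "?rho i \<circ> ?rho j = ?rho j \<circ> ?rho i" using comm that by metis
    have "(?rho i \<circ> ?rho j) ^^ 2 = ?rho i \<circ> ?rho j \<circ> (?rho i \<circ> ?rho j)"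
      by (simp only: numeral_2_eq_2 funpow.simps comp_id)
    also have "\<dots> = ?rho i \<circ> ?rho j \<circ> (?rho j \<circ> ?rho i)" by (simp only: c)
    also have "\<dots> = ?rho i \<circ> (?rho j \<circ> ?rho j) \<circ> ?rho i" by (simp only: comp_assoc)
    also have "\<dots> = id" using inv that(1,2) by simp
    finally show ?thesis .
  qed
  show "sggi (alt_group n) ?rho 5"
    unfolding sggi_def alt_group_one alt_group_mult alt_group_pow
    using nontriv inv sq graph_rho_carrier alt_group_is_group generate_alt_group[OF order_refl] gen_all
    by blast
  show "intersection_property (alt_group n) ?rho 5"
    unfolding intersection_property_def
  proof (intro allI impI)
    fix J K :: "nat set" assume JK: "J \<subseteq> {..<5}" "K \<subseteq> {..<5}"
    have "gen J \<inter> gen K = gen (J \<inter> K)"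
    proof (intro equalityI subsetI)
      fix g assume g: "g \<in> gen J \<inter> gen K"
      show "g \<in> gen (J \<inter> K)"
      proof (rule Inter_gen_omit)
        show "J \<inter> K \<subseteq> {..<5}" using JK by blast
        show "g \<in> gen {..<5}" using g JK by (blast intro: gen_mono)
        fix k assume "k < 5" "k \<notin> J \<inter> K"
        then have "J \<subseteq> {..<5} - {k} \<or> K \<subseteq> {..<5} - {k}" using JK by blast
        then show "g \<in> gen ({..<5} - {k})" using g by (blast intro: gen_mono)
      qed
    qed (blast intro: gen_mono)
    moreover have "J \<inter> K \<subseteq> {..<5}" using JK by blast
    ultimately show "generate (alt_group n) (?rho ` J) \<inter> generate (alt_group n) (?rho ` K)
        = generate (alt_group n) (?rho ` (J \<inter> K))"
      using JK by (simp only: generate_alt_group)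
  qed
qed

lemma schlafli_type_alt: "schlafli_type (alt_group n) (graph_rho (thm45_edges n)) 5 = [3, 4, 6, n - 7]"
proof -
  let ?rho = "graph_rho (thm45_edges n)"
  have "?rho i \<circ> ?rho j \<in> carrier (alt_group n)" if "i < 5" "j < 5" for i j
    using monoid.m_closed[OF group.is_monoid[OF alt_group_is_group]] graph_rho_carrier that
    by (metis alt_group_mult)
  then have ord: "group.ord (alt_group n) (?rho i \<circ> ?rho j) = d"
    if "i < 5" "j < 5" "\<And>k. (?rho i \<circ> ?rho j) ^^ k = id \<longleftrightarrow> d dvd k" for i j d
    using that ord_alt_group by blast
  have "group.ord (alt_group n) (?rho 0 \<circ> ?rho (Suc 0)) = 3"
    by (rule ord) (simp_all only: graph_rho_simps r0_comp_r1_funpow)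
  moreover have "group.ord (alt_group n) (?rho (Suc 0) \<circ> ?rho 2) = 4"
    by (rule ord) (simp_all only: graph_rho_simps r1_comp_r2_funpow)
  moreover have "group.ord (alt_group n) (?rho 2 \<circ> ?rho 3) = 6"
    by (rule ord) (simp_all only: graph_rho_simps r2_comp_r3_funpow)
  moreover have "group.ord (alt_group n) (?rho 3 \<circ> ?rho 4) = n - 7"
    by (rule ord) (simp_all only: graph_rho_simps r3_comp_r4_funpow_eq_id)
  moreover have "[1..<5] = [1, 2, 3, 4::nat]" by (simp add: upt_rec)
  ultimately show ?thesis by (simp add: schlafli_type_def alt_group_mult)
qed

end

theorem theorem4p5:
  fixes n :: nat
  assumes "n \<ge> 12" and "n mod 4 = 0"
  shows "let rho = graph_rho (thm45_edges n);
             G = subgroup_generated (sym_group n) (rho ` {..<5})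
         in G \<cong> alt_group n
            \<and> string_C_group G rho 5
            \<and> schlafli_type G rho 5 = [3, 4, 6, n - 7]"
proof -
  interpret alternating_graph n using assms by unfold_locales
  show ?thesis
    using string_C_group_alt schlafli_type_alt
    by (simp add: Let_def subgroup_generated_graph_rho iso_refl)
qed

end
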